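(* Suppose that $\beta=0$ (only exclusion moves occur) and $p\in[0,1]$. (i) Let the initial configuration $\xi_0=S_0\in\mathcal{D}$ be fixed. There exists $C\in(0,\infty)$ such that for any $p\in[0,1]$, $\mathbb{P}_{0,p}$-a.s., for all $t\in\mathbb{Z}^+$ with $t\ge1$, $$\max_{0\le s\le t}N(\xi_s)\le C\,t^{1/2}.$$ (ii) Suppose that $p\in[0,1/2)$. Then, for any fixed initial configuration $\xi_0=S_0\in\mathcal{D}$ and any $\varepsilon>0$, $\mathbb{P}_{0,p}$-a.s., for all but finitely many $t\in\mathbb{Z}^+$, $$\max_{0\le s\le t}|\xi_s|\le t^{2/3}(\log t)^{(1/3)+\varepsilon}.$$ On the other hand, there exists $c(p)\in(0,\infty)$ such that for any $c\in(0,c(p))$ and any fixed initial configuration $\xi_0=S_0\in\mathcal{D}$, $\mathbb{P}_{0,p}$-a.s., for all but finitely many $t\in\mathbb{Z}^+$, $$|\xi_t|\ge c\,t^{1/2}.$$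
   Context: Configurations: let $\mathcal{D}'\subset\{0,1\}^{\mathbb{Z}}$ be the set of configurations with finitely many $0$'s to the left of the origin and finitely many $1$'s to the right. Call $S,S'\in\mathcal{D}'$ equivalent if they are translates of each other, and let $\mathcal{D}$ be the (countable) set of equivalence classes. So each $S\in\mathcal{D}$ is an infinite string of $1$'s, followed by a finite string of $0$'s and $1$'s, followed by an infinite string of $0$'s, modulo translation. The ground state is $\mathcal{D}_0=\ldots 111000\ldots$ (up to translation). An unlike pair is a pair of adjacent sites with labels $01$ or $10$ (read left to right); each configuration has finitely many of them and at least one. Process: for $\beta,p\in[0,1]$ the discrete-time exclusion-voter process $\xi=(\xi_t)_{t\in\mathbb{Z}^+}$, $\mathbb{Z}^+=\{0,1,2,\ldots\}$, is the time-homogeneous Markov chain on $\mathcal{D}$ with the following one-step dynamics. At each time step, independently, a voter move is chosen with probability $\beta$ and an exclusion move with probability $1-\beta$; then one of the unlike pairs of the current configuration is chosen uniformly at random. In a voter move the chosen pair is replaced by $00$ or by $11$, each with probability $1/2$. In an exclusion move, a chosen pair $01$ becomes $10$ with probability $p$ (otherwise no change), and a chosen pair $10$ becomes $01$ with probability $1-p$ (otherwise no change). Its law is denoted $\mathbb{P}_{\beta,p}$. Block notation: a $1$-block ($0$-block) is a maximal string of consecutive $1$'s ($0$'s). $N(S)\ge0$ is the number of $1$-blocks of $S$ not counting the infinite $1$-block on the left (equivalently, the number of $0$-blocks not counting the infinite $0$-block on the right). For $S\ne\mathcal{D}_0$, enumerating left to right, $n_i$ is the size of the $i$th finite $0$-block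 and $m_i$ the size of the $i$th finite $1$-block, $1\le i\le N(S)$. The size of the hybrid zone is $|S|=\sum_{i=1}^{N(S)}(n_i+m_i)$, and $|\mathcal{D}_0|=0$. *)

theory Defs
  imports "HOL-Probability.Probability"
begin

section \<open>Configurations\<close>

text \<open>
  A site with value \<^term>\<open>True\<close> carries a 1, a site with value \<^term>\<open>False\<close> carries a 0.
\<close>

definition hybrid_confs :: "(int \<Rightarrow> bool) set" where
  "hybrid_confs = {S. finite {x. x < 0 \<and> \<not> S x} \<and> finite {x. x > 0 \<and> S x}}"

definition translate_equiv :: "(int \<Rightarrow> bool) \<Rightarrow> (int \<Rightarrow> bool) \<Rightarrow> bool" where
  "translate_equiv S S' \<longleftrightarrow>
     S \<in> hybrid_confs \<and> S' \<in> hybrid_confs \<and> (\<exists>k. \<forall>x. S' x = S (x + k))"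

lemma hybrid_confs_iff:
  "S \<in> hybrid_confs \<longleftrightarrow> (\<exists>a b. (\<forall>x\<le>a. S x) \<and> (\<forall>x\<ge>b. \<not> S x))"
proof
  assume S: "S \<in> hybrid_confs"
  then have fin: "finite {x. x < 0 \<and> \<not> S x}" "finite {x. x > 0 \<and> S x}"
    by (auto simp: hybrid_confs_def)
  have "\<exists>a. \<forall>x\<le>a. S x"
  proof -
    have "bdd_below {x. x < 0 \<and> \<not> S x}" using fin(1) by simp
    then obtain m where m: "\<And>x. x < 0 \<Longrightarrow> \<not> S x \<Longrightarrow> m \<le> x"
      by (auto simp: bdd_below_def)
    have "S x" if "x \<le> min m 0 - 1" for x
      using m[of x] that by (cases "S x") auto
    then show ?thesis by blast
  qed
  moreover have "\<exists>b. \<forall>x\<ge>b. \<not> S x"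
  proof -
    have "bdd_above {x. x > 0 \<and> S x}" using fin(2) by simp
    then obtain m where m: "\<And>x. x > 0 \<Longrightarrow> S x \<Longrightarrow> x \<le> m"
      by (auto simp: bdd_above_def)
    have "\<not> S x" if "x \<ge> max m 0 + 1" for x
      using m[of x] that by linarith
    then show ?thesis by blast
  qed
  ultimately show "\<exists>a b. (\<forall>x\<le>a. S x) \<and> (\<forall>x\<ge>b. \<not> S x)" by blast
next
  assume "\<exists>a b. (\<forall>x\<le>a. S x) \<and> (\<forall>x\<ge>b. \<not> S x)"
  then obtain a b where ab: "\<And>x. x \<le> a \<Longrightarrow> S x" "\<And>x. x \<ge> b \<Longrightarrow> \<not> S x" by blast
  have "{x. x < 0 \<and> \<not> S x} \<subseteq> {a..0}" using ab(1) by (auto, meson linear)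
  moreover have "{x. x > 0 \<and> S x} \<subseteq> {0..b}" using ab(2) by (auto, meson linear)
  ultimately show "S \<in> hybrid_confs"
    by (simp add: hybrid_confs_def finite_subset[OF _ finite_atLeastAtMost_int])
qed

lemma shift_hybrid_confs:
  assumes "S \<in> hybrid_confs"
  shows "(\<lambda>x. S (x + k)) \<in> hybrid_confs"
proof -
  obtain a b where ab: "\<And>x. x \<le> a \<Longrightarrow> S x" "\<And>x. x \<ge> b \<Longrightarrow> \<not> S x"
    using assms unfolding hybrid_confs_iff by blast
  show ?thesis unfolding hybrid_confs_iff
    using ab by (intro exI[of _ "a - k"] exI[of _ "b - k"]) (simp add: diff_le_eq le_diff_eq)
qed

lemma translate_equivE:
  assumes "translate_equiv S S'"
  obtains k where "S \<in> hybrid_confs" "S' = (\<lambda>x. S (x + k))"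
  using assms by (auto simp: translate_equiv_def)

lemma translate_equivI:
  "S \<in> hybrid_confs \<Longrightarrow> translate_equiv S (\<lambda>x. S (x + k))"
  by (auto simp: translate_equiv_def shift_hybrid_confs)

lemma part_equivp_translate_equiv: "part_equivp translate_equiv"
proof (rule part_equivpI)
  have "(\<lambda>x::int. x \<le> 0) \<in> hybrid_confs"
    unfolding hybrid_confs_iff by (rule exI[of _ 0], rule exI[of _ 1]) auto
  then show "\<exists>S. translate_equiv S S"
    by (auto simp: translate_equiv_def intro!: exI[of _ "0::int"])
  show "symp translate_equiv"
  proof (rule sympI)
    fix S S' assume *: "translate_equiv S S'"
    then obtain k where k: "S' = (\<lambda>x. S (x + k))" by (rule translate_equivE)
    then have "\<forall>x. S x = S' (x + (- k))" by simp
    with * show "translate_equiv S' S" unfolding translate_equiv_def by blast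
  qed
  show "transp translate_equiv"
  proof (rule transpI)
    fix S S' S'' assume *: "translate_equiv S S'" "translate_equiv S' S''"
    then obtain k l where "\<forall>x. S' x = S (x + k)" "\<forall>x. S'' x = S' (x + l)"
      by (auto simp: translate_equiv_def)
    then have "\<forall>x. S'' x = S (x + (l + k))" by (simp add: add.assoc)
    with * show "translate_equiv S S''" unfolding translate_equiv_def by blast
  qed
qed

quotient_type config = "int \<Rightarrow> bool" / partial: translate_equiv
  by (rule part_equivp_translate_equiv)


section \<open>Blocks\<close>

text \<open>
  Since only finite blocks are collected, the infinite 1-block on the left and the infinite
  0-block on the right are never counted.
\<close>

definition finite_blocks :: "bool \<Rightarrow> (int \<Rightarrow> bool) \<Rightarrow> int set set" where
  "finite_blocks a S =
     {{i..j} |i j. i \<le> j \<and> (\<forall>x\<in>{i..j}. S x = a) \<and> S (i - 1) \<noteq> a \<and> S (j + 1) \<noteq> a}"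

lemma finite_finite_blocks:
  assumes "S \<in> hybrid_confs"
  shows "finite (finite_blocks a S)"
proof -
  obtain l r where lr: "\<And>x. x \<le> l \<Longrightarrow> S x" "\<And>x. x \<ge> r \<Longrightarrow> \<not> S x"
    using assms unfolding hybrid_confs_iff by blast
  have "finite_blocks a S \<subseteq> Pow {l..r}"
  proof
    fix B assume "B \<in> finite_blocks a S"
    then obtain i j where B: "B = {i..j}" "i \<le> j" "\<forall>x\<in>{i..j}. S x = a"
      "S (i - 1) \<noteq> a" "S (j + 1) \<noteq> a"
      unfolding finite_blocks_def by blast
    have Sij: "S i = a" "S j = a" using B by auto
    have "l \<le> i" using lr(1)[of i] lr(1)[of "i - 1"] Sij B(4) by (cases "l \<le> i") auto
    moreover have "j \<le> r" using lr(2)[of j] lr(2)[of "j + 1"] Sij B(5) by (cases "j \<le> r") auto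
    ultimately show "B \<in> Pow {l..r}" using B(1) by auto
  qed
  then show ?thesis by (rule finite_subset) simp
qed

lemma finite_blocks_shift:
  "finite_blocks a (\<lambda>x. S (x + k)) = image (\<lambda>x. x - k) ` finite_blocks a S"
proof -
  have *: "image (\<lambda>x. x - k) ` finite_blocks a S \<subseteq> finite_blocks a (\<lambda>x. S (x + k))" for k :: int and S
  proof safe
    fix B assume "B \<in> finite_blocks a S"
    then obtain i j where B: "B = {i..j}" "i \<le> j" "\<forall>x\<in>{i..j}. S x = a"
      "S (i - 1) \<noteq> a" "S (j + 1) \<noteq> a"
      unfolding finite_blocks_def by blast
    have "(\<lambda>x. x - k) ` B = {i - k..j - k}"
      using B(1) by simp
    moreover have "i - k - 1 + k = i - 1" "j - k + 1 + k = j + 1" by simp_all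
    ultimately show "(\<lambda>x. x - k) ` B \<in> finite_blocks a (\<lambda>x. S (x + k))"
      unfolding finite_blocks_def using B
      by (intro CollectI exI[of _ "i - k"] exI[of _ "j - k"]) auto
  qed
  show ?thesis
  proof
    have "finite_blocks a (\<lambda>x. S (x + k))
          = image (\<lambda>x. x - k) ` image (\<lambda>x. x - (- k)) ` finite_blocks a (\<lambda>x. S (x + k))"
      by (simp add: image_image)
    also have "\<dots> \<subseteq> image (\<lambda>x. x - k) ` finite_blocks a (\<lambda>x. S (x + k + (- k)))"
      using *[of "- k" "\<lambda>x. S (x + k)"] by (intro image_mono) (simp add: add.assoc)
    finally show "finite_blocks a (\<lambda>x. S (x + k)) \<subseteq> image (\<lambda>x. x - k) ` finite_blocks a S"
      by simp
  qed (rule *)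
qed

lemma inj_image_shift: "inj (image (\<lambda>x::int. x - k))"
proof (rule injI)
  fix A B :: "int set" assume "(\<lambda>x. x - k) ` A = (\<lambda>x. x - k) ` B"
  then show "A = B" by (subst (asm) inj_image_eq_iff) (auto intro: injI)
qed

lemma card_finite_blocks_shift:
  "card (finite_blocks a (\<lambda>x. S (x + k))) = card (finite_blocks a S)"
  unfolding finite_blocks_shift[of a S k]
  by (rule card_image[OF inj_on_subset[OF inj_image_shift subset_UNIV]])

lemma sum_card_finite_blocks_shift:
  "(\<Sum>B\<in>finite_blocks a (\<lambda>x. S (x + k)). card B) = (\<Sum>B\<in>finite_blocks a S. card B)"
  unfolding finite_blocks_shift[of a S k]
  by (subst sum.reindex[OF inj_on_subset[OF inj_image_shift subset_UNIV]])
     (auto intro!: sum.cong card_image inj_onI)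

lift_definition num_blocks :: "config \<Rightarrow> nat" is "\<lambda>S. card (finite_blocks True S)"
  by (erule translate_equivE) (simp only: card_finite_blocks_shift)

text \<open>
  The sum over \<open>i\<close> of \<open>n\<^sub>i + m\<^sub>i\<close>, with the 0-blocks and the 1-blocks summed separately.
\<close>

lift_definition zone_size :: "config \<Rightarrow> nat" is
  "\<lambda>S. (\<Sum>B\<in>finite_blocks False S. card B) + (\<Sum>B\<in>finite_blocks True S. card B)"
  by (erule translate_equivE) (simp only: sum_card_finite_blocks_shift)


section \<open>One-step dynamics\<close>

text \<open>
  In the definitions below a site \<^term>\<open>x\<close> stands for the unlike pair at \<^term>\<open>x\<close> and \<^term>\<open>x + 1\<close>.
\<close>

definition unlike_pairs :: "(int \<Rightarrow> bool) \<Rightarrow> int set" where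
  "unlike_pairs S = {x. S x \<noteq> S (x + 1)}"

definition voter_move :: "(int \<Rightarrow> bool) \<Rightarrow> int \<Rightarrow> (int \<Rightarrow> bool) pmf" where
  "voter_move S x = map_pmf (\<lambda>b. S(x := b, x + 1 := b)) (bernoulli_pmf (1 / 2))"

definition exclusion_move :: "real \<Rightarrow> (int \<Rightarrow> bool) \<Rightarrow> int \<Rightarrow> (int \<Rightarrow> bool) pmf" where
  "exclusion_move p S x =
     map_pmf (\<lambda>b. if b then S(x := S (x + 1), x + 1 := S x) else S)
       (bernoulli_pmf (if \<not> S x \<and> S (x + 1) then p else 1 - p))"

definition step_rep :: "real \<Rightarrow> real \<Rightarrow> (int \<Rightarrow> bool) \<Rightarrow> (int \<Rightarrow> bool) pmf" where
  "step_rep \<beta> p S =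
     do {
       voter \<leftarrow> bernoulli_pmf \<beta>;
       x \<leftarrow> pmf_of_set (unlike_pairs S);
       if voter then voter_move S x else exclusion_move p S x
     }"

lemma unlike_pairs_finite_nonempty:
  assumes "S \<in> hybrid_confs"
  shows "finite (unlike_pairs S)" "unlike_pairs S \<noteq> {}"
proof -
  obtain a b where ab: "\<And>x. x \<le> a \<Longrightarrow> S x" "\<And>x. x \<ge> b \<Longrightarrow> \<not> S x"
    using assms unfolding hybrid_confs_iff by blast
  have "x \<in> {a..b}" if "x \<in> unlike_pairs S" for x
  proof -
    have "S x \<noteq> S (x + 1)" using that by (simp add: unlike_pairs_def)
    then have "\<not> x < a" "\<not> b < x" using ab(1)[of x] ab(1)[of "x + 1"] ab(2)[of x] ab(2)[of "x + 1"] by auto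
    then show ?thesis by simp
  qed
  then show "finite (unlike_pairs S)" by (meson finite_atLeastAtMost_int finite_subset subsetI)
  show "unlike_pairs S \<noteq> {}"
  proof
    assume "unlike_pairs S = {}"
    then have eq: "S x = S (x + 1)" for x by (auto simp: unlike_pairs_def)
    have "S (a + int n)" for n
    proof (induction n)
      case (Suc n)
      then show ?case using eq[of "a + int n"] by (simp add: algebra_simps)
    qed (use ab(1) in simp)
    from this[of "nat (b - a)"] show False using ab(1)[of b] ab(2)[of b] ab(2)[of a]
      by (cases "a \<le> b") auto
  qed
qed

lemma hybrid_confs_fun_upd:
  assumes "S \<in> hybrid_confs"
  shows "S(y := c) \<in> hybrid_confs"
proof -
  obtain a b where ab: "\<And>x. x \<le> a \<Longrightarrow> S x" "\<And>x. x \<ge> b \<Longrightarrow> \<not> S x"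
    using assms unfolding hybrid_confs_iff by blast
  show ?thesis unfolding hybrid_confs_iff
    using ab by (intro exI[of _ "min a (y - 1)"] exI[of _ "max b (y + 1)"]) auto
qed

lemma set_step_rep:
  assumes "S \<in> hybrid_confs" "T \<in> set_pmf (step_rep \<beta> p S)"
  shows "T \<in> hybrid_confs"
proof -
  have "T \<in> hybrid_confs" if "T \<in> set_pmf (voter_move S x)" for x
    using that assms(1) by (auto simp only: voter_move_def set_map_pmf hybrid_confs_fun_upd)
  moreover have "T \<in> hybrid_confs" if "T \<in> set_pmf (exclusion_move p S x)" for x
    using that assms(1)
    by (auto simp only: exclusion_move_def set_map_pmf hybrid_confs_fun_upd split: if_splits)
  moreover obtain v x where "T \<in> set_pmf (if v then voter_move S x else exclusion_move p S x)"
    using assms(2) unfolding step_rep_def set_bind_pmf by blast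
  ultimately show ?thesis by (cases v) simp_all
qed

lemma unlike_pairs_shift: "unlike_pairs (\<lambda>x. S (x + k)) = (\<lambda>x. x - k) ` unlike_pairs S"
proof -
  have "x \<in> (\<lambda>x. x - k) ` unlike_pairs S" if "S (x + k) \<noteq> S (x + 1 + k)" for x
    using that by (intro image_eqI[of _ _ "x + k"]) (auto simp: unlike_pairs_def add_ac)
  then show ?thesis by (auto simp: unlike_pairs_def algebra_simps)
qed

lemma fun_upd_shift:
  fixes S :: "int \<Rightarrow> bool"
  shows "(\<lambda>y. S (y + k))(x - k := c, x - k + 1 := d) = (\<lambda>y. (S(x := c, x + 1 := d)) (y + k))"
proof
  fix y
  have "(y = x - k + 1) = (y + k = x + 1)" "(y = x - k) = (y + k = x)" by arith+
  then show "((\<lambda>y. S (y + k))(x - k := c, x - k + 1 := d)) y = (S(x := c, x + 1 := d)) (y + k)"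
    by (simp only: fun_upd_apply)
qed

lemma step_rep_shift:
  assumes "S \<in> hybrid_confs"
  shows "step_rep \<beta> p (\<lambda>x. S (x + k)) = map_pmf (\<lambda>T x. T (x + k)) (step_rep \<beta> p S)"
proof -
  have *: "pmf_of_set (unlike_pairs (\<lambda>x. S (x + k))) = map_pmf (\<lambda>x. x - k) (pmf_of_set (unlike_pairs S))"
    unfolding unlike_pairs_shift using unlike_pairs_finite_nonempty[OF assms]
    by (intro map_pmf_of_set_inj[symmetric]) (auto intro: inj_onI)
  have v: "voter_move (\<lambda>x. S (x + k)) (x - k) = map_pmf (\<lambda>T x. T (x + k)) (voter_move S x)" for x
    unfolding voter_move_def fun_upd_shift by (simp add: pmf.map_comp o_def)
  have x1: "x - k + 1 + k = x + 1" for x by simp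
  have e: "exclusion_move p (\<lambda>x. S (x + k)) (x - k) = map_pmf (\<lambda>T x. T (x + k)) (exclusion_move p S x)" for x
    unfolding exclusion_move_def fun_upd_shift x1
    by (auto simp: pmf.map_comp o_def intro!: map_pmf_cong)
  show ?thesis
    unfolding step_rep_def *
    by (auto simp: map_bind_pmf bind_map_pmf v e intro!: bind_pmf_cong)
qed

lift_definition exclusion_voter_step :: "real \<Rightarrow> real \<Rightarrow> config \<Rightarrow> config pmf" is step_rep
proof -
  fix \<beta> p S S' assume "translate_equiv S S'"
  then obtain k where k: "S \<in> hybrid_confs" "S' = (\<lambda>x. S (x + k))" by (rule translate_equivE)
  show "rel_pmf translate_equiv (step_rep \<beta> p S) (step_rep \<beta> p S')"
    unfolding k(2) step_rep_shift[OF k(1)] pmf.rel_map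
    by (intro rel_pmf_reflI translate_equivI set_step_rep[OF k(1)])
qed


section \<open>Law of a Markov chain\<close>

text \<open>
  The law of the path of a time-homogeneous Markov chain on a discrete state space, with
  transition probabilities \<^term>\<open>K\<close> and deterministic initial state \<^term>\<open>s\<close>.
\<close>

text \<open>
  The conditional law of the state at time \<^term>\<open>n\<close>, given the path \<^term>\<open>\<omega>\<close> before \<^term>\<open>n\<close>.
\<close>

definition chain_kernel :: "('s \<Rightarrow> 's pmf) \<Rightarrow> 's \<Rightarrow> nat \<Rightarrow> (nat \<Rightarrow> 's) \<Rightarrow> 's pmf" where
  "chain_kernel K s n \<omega> = (case n of 0 \<Rightarrow> return_pmf s | Suc m \<Rightarrow> K (\<omega> m))"

definition chain_law :: "('s \<Rightarrow> 's pmf) \<Rightarrow> 's \<Rightarrow> (nat \<Rightarrow> 's) measure" where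
  "chain_law K s =
     projective_family.lim UNIV
       (Ionescu_Tulcea.CI (\<lambda>n \<omega>. measure_pmf (chain_kernel K s n \<omega>)) (\<lambda>_. count_space UNIV))
       (\<lambda>_. count_space UNIV)"

lemma Ionescu_Tulcea_chain_kernel:
  "Ionescu_Tulcea (\<lambda>n \<omega>. measure_pmf (chain_kernel K s n \<omega>)) (\<lambda>_. count_space UNIV)"
proof
  fix n
  show "(\<lambda>\<omega>. measure_pmf (chain_kernel K s n \<omega>))
        \<in> measurable (PiM {0..<n} (\<lambda>_. count_space UNIV)) (subprob_algebra (count_space UNIV))"
  proof (cases n)
    case 0
    then show ?thesis
      by (simp add: chain_kernel_def space_subprob_algebra measure_pmf.subprob_space_axioms)
  next
    case (Suc m)
    have "(\<lambda>\<omega>. \<omega> m) \<in> measurable (PiM {0..<n} (\<lambda>_. count_space (UNIV :: 'a set))) (count_space UNIV)"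
      using Suc by (intro measurable_component_singleton) auto
    moreover have "(\<lambda>x. measure_pmf (K x)) \<in> measurable (count_space UNIV) (subprob_algebra (count_space UNIV))"
      by (simp add: space_subprob_algebra measure_pmf.subprob_space_axioms)
    ultimately have "(\<lambda>\<omega>. measure_pmf (K (\<omega> m)))
        \<in> measurable (PiM {0..<n} (\<lambda>_. count_space UNIV)) (subprob_algebra (count_space UNIV))"
      by (rule measurable_compose)
    then show ?thesis
      by (simp only: Suc chain_kernel_def nat.case)
  qed
qed

context
  fixes K :: "'s \<Rightarrow> 's pmf" and s :: 's
begin

interpretation IT: Ionescu_Tulcea
  "\<lambda>n \<omega>. measure_pmf (chain_kernel K s n \<omega>)" "\<lambda>_. count_space (UNIV :: 's set)"
  by (rule Ionescu_Tulcea_chain_kernel)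

lemma sets_chain_law: "sets (chain_law K s) = sets (PiM UNIV (\<lambda>_. count_space UNIV))"
  unfolding chain_law_def by (rule IT.PF.sets_lim)

lemma space_chain_law: "space (chain_law K s) = UNIV"
  unfolding chain_law_def by (simp only: IT.PF.space_lim) (simp add: space_PiM)

lemma prob_space_chain_law: "prob_space (chain_law K s)"
proof
  let ?N = "PiM {} (\<lambda>_::nat. count_space (UNIV :: 's set))"
  have "emeasure IT.PF.lim (IT.PF.emb UNIV {} (space ?N)) = emeasure (IT.CI {}) (space ?N)"
    by (rule IT.lim) auto
  also have "\<dots> = 1"
    using prob_space.emeasure_space_1[OF IT.PF.prob_space_P[of "{}"]] by (simp add: IT.PF.space_P)
  also have "IT.PF.emb UNIV {} (space ?N) = UNIV"
    by (auto simp: prod_emb_def space_PiM PiE_def)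
  finally show "emeasure (chain_law K s) (space (chain_law K s)) = 1"
    unfolding space_chain_law by (simp add: chain_law_def)
qed

lemma emeasure_C_singleton:
  "emeasure (IT.C 0 n (\<lambda>_. undefined)) {restrict x {0..<n}} =
     (\<Prod>i<n. ennreal (pmf (chain_kernel K s i x) (x i)))"
proof (induction n)
  case 0
  show ?case by (simp add: PiM_empty)
next
  case (Suc n)
  let ?N = "\<lambda>n. PiM {0..<n} (\<lambda>_::nat. count_space (UNIV :: 's set))"
  let ?C = "IT.C 0 n (\<lambda>_. undefined)"
  let ?r = "\<lambda>n. restrict x {0..<n}"
  have sing: "{?r n} \<in> sets (?N n)" for n
  proof -
    have "{?r n} = (\<Pi>\<^sub>E i\<in>{0..<n}. {x i})"
      by (auto simp: PiE_iff extensional_def restrict_def fun_eq_iff)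
    also have "\<dots> \<in> sets (?N n)" by (rule sets_PiM_I_finite) auto
    finally show ?thesis .
  qed
  have spC: "space ?C = space (?N n)" "sets ?C = sets (?N n)"
    using IT.space_C[of "\<lambda>_. undefined" 0 n] IT.sets_C[of "\<lambda>_. undefined" 0 n]
    by (simp_all add: space_PiM)
  have "emeasure (IT.C 0 (Suc n) (\<lambda>_. undefined)) {?r (Suc n)}
      = (\<integral>\<^sup>+\<omega>. emeasure (IT.eP n \<omega>) {?r (Suc n)} \<partial>?C)"
    using sing[of "Suc n"] IT.measurable_eP[of n]
    by (simp, subst emeasure_bind[where N = "?N (Suc n)"])
       (auto simp: spC space_PiM measurable_cong_sets[OF spC(2) refl])
  also have "\<dots> = (\<integral>\<^sup>+\<omega>. ennreal (pmf (chain_kernel K s n x) (x n)) * indicator {?r n} \<omega> \<partial>?C)"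
  proof (rule nn_integral_cong)
    fix \<omega> assume "\<omega> \<in> space ?C"
    then have w: "\<omega> \<in> space (?N n)" by (simp add: spC)
    have "emeasure (IT.eP n \<omega>) {?r (Suc n)}
        = emeasure (measure_pmf (chain_kernel K s n \<omega>)) (fun_upd \<omega> n -` {?r (Suc n)})"
      using IT.emeasure_eP[OF w sing] by simp
    also have "\<dots> = ennreal (pmf (chain_kernel K s n x) (x n)) * indicator {?r n} \<omega>"
    proof (cases "\<omega> = ?r n")
      case True
      have "fun_upd \<omega> n -` {?r (Suc n)} = {x n}"
        unfolding True by (auto simp: fun_eq_iff restrict_def less_Suc_eq split: if_splits)
      moreover have "chain_kernel K s n \<omega> = chain_kernel K s n x"
        unfolding True by (simp add: chain_kernel_def split: nat.split)
      ultimately show ?thesis using True by (simp add: emeasure_pmf_single)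
    next
      case False
      have "fun_upd \<omega> n -` {?r (Suc n)} = {}"
      proof -
        have "\<omega> = ?r n" if eq: "fun_upd \<omega> n y = ?r (Suc n)" for y
        proof
          fix i
          show "\<omega> i = ?r n i"
            using fun_cong[OF eq, of i] w
            by (cases "i = n") (auto simp: space_PiM PiE_iff extensional_def restrict_def less_Suc_eq split: if_splits)
        qed
        with False show ?thesis by auto
      qed
      with False show ?thesis by simp
    qed
    finally show "emeasure (IT.eP n \<omega>) {?r (Suc n)}
        = ennreal (pmf (chain_kernel K s n x) (x n)) * indicator {?r n} \<omega>" .
  qed
  also have "\<dots> = ennreal (pmf (chain_kernel K s n x) (x n)) * emeasure ?C {?r n}"
    by (rule nn_integral_cmult_indicator) (simp add: spC sing)
  finally show ?case
    by (simp only: Suc.IH prod.lessThan_Suc mult.commute)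
qed

theorem emeasure_chain_law_cylinder:
  "emeasure (chain_law K s) {\<omega>. \<forall>i\<le>n. \<omega> i = x i} =
     (if x 0 = s then \<Prod>i<n. ennreal (pmf (K (x i)) (x (Suc i))) else 0)"
proof -
  let ?J = "{0..<Suc n}"
  let ?X = "{restrict x ?J}"
  have X: "?X \<in> sets (PiM ?J (\<lambda>_. count_space UNIV))"
  proof -
    have "?X = (\<Pi>\<^sub>E i\<in>?J. {x i})"
      by (auto simp: PiE_iff extensional_def restrict_def fun_eq_iff)
    also have "\<dots> \<in> sets (PiM ?J (\<lambda>_. count_space UNIV))" by (rule sets_PiM_I_finite) auto
    finally show ?thesis .
  qed
  have "{\<omega>. \<forall>i\<le>n. \<omega> i = x i} = IT.PF.emb UNIV ?J ?X"
    by (auto simp: prod_emb_def fun_eq_iff less_Suc_eq_le restrict_apply split: if_splits)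
  then have "emeasure (chain_law K s) {\<omega>. \<forall>i\<le>n. \<omega> i = x i} = emeasure (IT.CI ?J) ?X"
    unfolding chain_law_def using IT.lim[OF _ X] by simp
  also have "\<dots> = emeasure (IT.C 0 (Suc n) (\<lambda>_. undefined)) (IT.PF.emb ?J ?J ?X)"
    by (rule IT.emeasure_CI[OF _ X]) simp
  also have "IT.PF.emb ?J ?J ?X = ?X"
    by (rule prod_emb_id) (auto simp: PiE_iff extensional_def)
  also have "emeasure (IT.C 0 (Suc n) (\<lambda>_. undefined)) ?X
      = (\<Prod>i<Suc n. ennreal (pmf (chain_kernel K s i x) (x i)))"
    by (rule emeasure_C_singleton)
  also have "\<dots> = (if x 0 = s then \<Prod>i<n. ennreal (pmf (K (x i)) (x (Suc i))) else 0)"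
    unfolding prod.lessThan_Suc_shift by (auto simp: chain_kernel_def)
  finally show ?thesis .
qed

end

definition exclusion_voter_law :: "real \<Rightarrow> real \<Rightarrow> config \<Rightarrow> (nat \<Rightarrow> config) measure" where
  "exclusion_voter_law \<beta> p S0 = chain_law (exclusion_voter_step \<beta> p) S0"

end

theory Submission
  imports Defs "HOL-Real_Asymp.Real_Asymp"
begin

text \<open>
  Three functions of a configuration carry the proof: the number of inversions (pairs of sites
  with a 0 to the left of a 1), the size of the hybrid zone, and a sum of exponentials of a height
  function. An exclusion move exchanges the labels of an unlike pair, and it raises the number of
  inversions by one if the pair was 10 and lowers it by one if the pair was 01. Hence the number of
  inversions at time \<open>t\<close> is at most its initial value plus \<open>t\<close> along almost every path. The inequality
  \<open>N\<^sup>2 \<le> 2 \<cdot> inversions\<close> (\<open>num_blocks_le\<close>) turns this into the bound on the number of blocks.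

  For \<open>p < 1/2\<close> a suitable \<open>v < 1\<close> has \<open>p \<le> (1 - p) v\<^sup>2\<close>. As there are more pairs 10 than pairs 01, the
  expectation of \<open>v\<close> to the power of the number of inversions shrinks by a constant factor in each
  step, so by Borel--Cantelli the number of inversions eventually exceeds a fixed multiple of \<open>t\<close>
  (\<open>AE_inversions_ge\<close>). Each inversion pairs a 0 of the zone with a 1 of the zone, hence
  \<open>4 \<cdot> inversions \<le> |S|\<^sup>2\<close> (\<open>zone_size_ge\<close>), which is the lower bound on the zone.

  For the upper bound, let the height at \<open>x\<close> be the number of 0's at sites up to \<open>x\<close> plus the
  number of 1's beyond \<open>x\<close>. Its graph has slopes \<open>\<plusminus>1\<close>, with a local minimum at each pair 10 and a
  local maximum at each pair 01, and a move at \<open>x\<close> flips that corner. By a variant of the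
  Hopf--Cole (or Gaertner) transform of the asymmetric exclusion process, the sum \<open>\<Phi>\<close> of \<open>v\<close> to the
  power of the height satisfies, with \<open>n\<close> unlike pairs present,
  \<open>E \<Delta>\<Phi> \<le> - (1 - p) (1 - v)\<^sup>2 \<Phi> / n\<close>: it decays at a constant rate on the time scale on which each
  unlike pair is served once (\<open>height_sum_drift\<close>). On the same time scale the zone grows at bounded
  speed, because only a move at the leftmost or at the rightmost pair 10 enlarges it. So for some
  \<open>u > 1\<close> the product \<open>u\<^bsup>|S|\<^esup> \<cdot> \<Phi>\<close> is a supermartingale (\<open>zone_height_sum_supermartingale\<close>), and
  eventually it stays below \<open>t\<^sup>2\<close>. Some height is at most twice the square root of the number of
  inversions (\<open>ex_low_height\<close>), so \<open>\<Phi>\<close> is not smaller than \<open>v\<close> to the power of a multiple of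
  \<open>\<surd>t\<close>. Therefore \<open>|S|\<close> is at most of order \<open>\<surd>t\<close>, which lies below the bound
  \<open>t\<^bsup>2/3\<^esup> (log t)\<^bsup>1/3+\<epsilon>\<^esup>\<close> claimed in the theorem.

  Every probabilistic estimate concerns the state at a single time, so of the law of the chain only
  its one-dimensional marginals enter.
\<close>

section \<open>The height function and inversions\<close>

definition zeros_upto :: "(int \<Rightarrow> bool) \<Rightarrow> int \<Rightarrow> nat" where
  "zeros_upto S x = card {y. y \<le> x \<and> \<not> S y}"

definition ones_beyond :: "(int \<Rightarrow> bool) \<Rightarrow> int \<Rightarrow> nat" where
  "ones_beyond S x = card {y. x < y \<and> S y}"

text \<open>
  A step of \<open>x\<close> to the right either raises the first summand by one or lowers the second one by
  one, so the graph is a lattice path; for a hybrid configuration it tends to infinity at both ends.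
  Counting from the two ends makes it commute with translations.
\<close>

definition height_at :: "(int \<Rightarrow> bool) \<Rightarrow> int \<Rightarrow> nat" where
  "height_at S x = zeros_upto S x + ones_beyond S x"

definition inversion_set :: "(int \<Rightarrow> bool) \<Rightarrow> (int \<times> int) set" where
  "inversion_set S = {(x, y). x < y \<and> \<not> S x \<and> S y}"

definition swap :: "(int \<Rightarrow> bool) \<Rightarrow> int \<Rightarrow> int \<Rightarrow> bool" where
  "swap S x = S(x := S (x + 1), x + 1 := S x)"

lemma swap_swap [simp]: "swap (swap S x) x = S"
  by (auto simp: swap_def fun_eq_iff)

lemma swap_apply [simp]: "swap S x x = S (x + 1)" "swap S x (x + 1) = S x"
  by (simp_all add: swap_def)

lemma swap_hybrid_confs: "S \<in> hybrid_confs \<Longrightarrow> swap S x \<in> hybrid_confs"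
  by (simp add: swap_def hybrid_confs_fun_upd)

lemma hybrid_confsE:
  assumes "S \<in> hybrid_confs"
  obtains a b where "a \<le> b" "\<And>x. x \<le> a \<Longrightarrow> S x" "\<And>x. x \<ge> b \<Longrightarrow> \<not> S x"
proof -
  obtain a b where ab: "\<And>x. x \<le> a \<Longrightarrow> S x" "\<And>x. x \<ge> b \<Longrightarrow> \<not> S x"
    using assms unfolding hybrid_confs_iff by blast
  then have "a \<le> b" by (meson linear)
  with ab show ?thesis using that by blast
qed

lemma finite_zeros_upto: "S \<in> hybrid_confs \<Longrightarrow> finite {y. y \<le> x \<and> \<not> S y}"
proof (erule hybrid_confsE)
  fix a b assume "\<And>x. x \<le> a \<Longrightarrow> S x"
  then have "{y. y \<le> x \<and> \<not> S y} \<subseteq> {a..x}" by (auto, meson linear)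
  then show ?thesis by (rule finite_subset) simp
qed

lemma finite_ones_beyond: "S \<in> hybrid_confs \<Longrightarrow> finite {y. x < y \<and> S y}"
proof (erule hybrid_confsE)
  fix a b assume "\<And>x. x \<ge> b \<Longrightarrow> \<not> S x"
  then have "{y. x < y \<and> S y} \<subseteq> {x..b}" by (auto, meson linear)
  then show ?thesis by (rule finite_subset) simp
qed

lemma finite_inversion_set:
  assumes "S \<in> hybrid_confs" shows "finite (inversion_set S)"
proof -
  obtain a b where ab: "\<And>x. x \<le> a \<Longrightarrow> S x" "\<And>x. x \<ge> b \<Longrightarrow> \<not> S x"
    using assms by (rule hybrid_confsE) blast
  have "inversion_set S \<subseteq> {a..b} \<times> {a..b}"
  proof (clarsimp simp: inversion_set_def)
    fix x y assume "x < y" "\<not> S x" "S y"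
    then show "a \<le> x \<and> x \<le> b \<and> a \<le> y \<and> y \<le> b"
      using ab(1)[of x] ab(2)[of y] by linarith
  qed
  then show ?thesis by (rule finite_subset) simp
qed

lemma zeros_upto_Suc:
  assumes "S \<in> hybrid_confs"
  shows "zeros_upto S (x + 1) = zeros_upto S x + (if S (x + 1) then 0 else 1)"
proof -
  have "{y. y \<le> x + 1 \<and> \<not> S y} =
      (if S (x + 1) then {} else {x + 1}) \<union> {y. y \<le> x \<and> \<not> S y}"
    by (auto simp: le_less zless_add1_eq)
  then show ?thesis
    using finite_zeros_upto[OF assms, of x] by (simp add: zeros_upto_def)
qed

lemma ones_beyond_Suc:
  assumes "S \<in> hybrid_confs"
  shows "ones_beyond S x = ones_beyond S (x + 1) + (if S (x + 1) then 1 else 0)"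
proof -
  have "x < y \<longleftrightarrow> y = x + 1 \<or> x + 1 < y" for y by auto
  then have "{y. x < y \<and> S y} =
      (if S (x + 1) then {x + 1} else {}) \<union> {y. x + 1 < y \<and> S y}"
    by auto
  then show ?thesis
    using finite_ones_beyond[OF assms, of "x + 1"] by (simp add: ones_beyond_def)
qed

lemma height_Suc:
  assumes "S \<in> hybrid_confs"
  shows "S (x + 1) \<Longrightarrow> height_at S x = Suc (height_at S (x + 1))"
    and "\<not> S (x + 1) \<Longrightarrow> height_at S (x + 1) = Suc (height_at S x)"
  using zeros_upto_Suc[OF assms, of x] ones_beyond_Suc[OF assms, of x]
  by (simp_all add: height_at_def)

text \<open>
  The exchange puts a 0 on \<open>x\<close> and a 1 beyond \<open>x\<close>; all other sites see both members of the pair on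
  the same side.
\<close>

lemma height_swap_10:
  assumes S: "S \<in> hybrid_confs" and x: "S x" "\<not> S (x + 1)"
  shows "height_at (swap S x) w = height_at S w + (if w = x then 2 else 0)"
proof -
  let ?T = "swap S x"
  have T: "?T y = (if y = x then False else if y = x + 1 then True else S y)" for y
    using x by (simp add: swap_def)
  have z: "zeros_upto ?T w = zeros_upto S w + (if w = x then 1 else 0)"
  proof -
    consider "w < x" | "w = x" | "w > x" by linarith
    then show ?thesis
    proof cases
      case 1
      then have "{y. y \<le> w \<and> \<not> ?T y} = {y. y \<le> w \<and> \<not> S y}" by (auto simp: T)
      with 1 show ?thesis by (simp add: zeros_upto_def)
    next
      case 2
      then have "{y. y \<le> w \<and> \<not> ?T y} = insert x {y. y \<le> w \<and> \<not> S y}" by (auto simp: T)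
      with 2 x finite_zeros_upto[OF S] show ?thesis by (simp add: zeros_upto_def)
    next
      case 3
      then have "{y. y \<le> w \<and> \<not> ?T y} = insert x ({y. y \<le> w \<and> \<not> S y} - {x + 1})"
        using x by (auto simp: T)
      moreover have "x + 1 \<in> {y. y \<le> w \<and> \<not> S y}" using 3 x by simp
      ultimately show ?thesis
        using 3 x finite_zeros_upto[OF S]
        by (simp add: zeros_upto_def card_Suc_Diff1 del: card_Diff_insert)
    qed
  qed
  have o: "ones_beyond ?T w = ones_beyond S w + (if w = x then 1 else 0)"
  proof -
    consider "w < x" | "w = x" | "w > x" by linarith
    then show ?thesis
    proof cases
      case 1
      then have "{y. w < y \<and> ?T y} = insert (x + 1) ({y. w < y \<and> S y} - {x})"
        using x by (auto simp: T)
      moreover have "x \<in> {y. w < y \<and> S y}" using 1 x by simp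
      ultimately show ?thesis
        using 1 x finite_ones_beyond[OF S]
        by (simp add: ones_beyond_def card_Suc_Diff1 del: card_Diff_insert)
    next
      case 2
      then have "{y. w < y \<and> ?T y} = insert (x + 1) {y. w < y \<and> S y}" by (auto simp: T)
      with 2 x finite_ones_beyond[OF S] show ?thesis by (simp add: ones_beyond_def)
    next
      case 3
      then have "{y. w < y \<and> ?T y} = {y. w < y \<and> S y}" by (auto simp: T)
      with 3 show ?thesis by (simp add: ones_beyond_def)
    qed
  qed
  show ?thesis using z o by (simp add: height_at_def)
qed

text \<open>
  The reverse of the move in the preceding lemma. The equation avoids subtraction of natural numbers.
\<close>

lemma height_swap_01:
  assumes S: "S \<in> hybrid_confs" and x: "\<not> S x" "S (x + 1)"
  shows "height_at S w = height_at (swap S x) w + (if w = x then 2 else 0)"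
  using height_swap_10[OF swap_hybrid_confs[OF S], of x x w] x by simp

text \<open>
  Transposing \<open>x\<close> and \<open>x + 1\<close> keeps the order of every other pair of sites, and so it maps the old
  inversions injectively to new ones; the only further inversion is the exchanged pair itself.
\<close>

lemma card_inversion_set_swap_10:
  assumes S: "S \<in> hybrid_confs" and x: "S x" "\<not> S (x + 1)"
  shows "card (inversion_set (swap S x)) = Suc (card (inversion_set S))"
proof -
  \<comment> \<open>the transposition of the two sites\<close>
  define \<tau> where "\<tau> y = (if y = x then x + 1 else if y = x + 1 then x else y)" for y
  have \<tau>\<tau>: "\<tau> (\<tau> y) = y" for y by (simp add: \<tau>_def)
  have T: "swap S x y = S (\<tau> y)" for y by (simp add: swap_def \<tau>_def)
  have mono: "\<tau> a < \<tau> b" if "a < b" "(a, b) \<noteq> (x, x + 1)" for a b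
    using that by (auto simp: \<tau>_def)
  have "inversion_set (swap S x) = insert (x, x + 1) (map_prod \<tau> \<tau> ` inversion_set S)"
  proof (intro equalityI subsetI)
    fix ab assume ab: "ab \<in> inversion_set (swap S x)"
    obtain a b where ab': "ab = (a, b)" by (cases ab)
    have "(a, b) \<in> map_prod \<tau> \<tau> ` inversion_set S" if "(a, b) \<noteq> (x, x + 1)"
      by (rule image_eqI[of _ _ "(\<tau> a, \<tau> b)"])
         (use ab that in \<open>auto simp: ab' \<tau>\<tau> inversion_set_def T intro!: mono\<close>)
    then show "ab \<in> insert (x, x + 1) (map_prod \<tau> \<tau> ` inversion_set S)" by (auto simp: ab')
  next
    fix ab assume "ab \<in> insert (x, x + 1) (map_prod \<tau> \<tau> ` inversion_set S)"
    then show "ab \<in> inversion_set (swap S x)"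
      using x by (auto simp: inversion_set_def T \<tau>\<tau> intro!: mono) (simp_all add: \<tau>_def)
  qed
  moreover have "(x, x + 1) \<notin> map_prod \<tau> \<tau> ` inversion_set S"
  proof
    assume "(x, x + 1) \<in> map_prod \<tau> \<tau> ` inversion_set S"
    then obtain a b where "a < b" "\<tau> a = x" "\<tau> b = x + 1" by (auto simp: inversion_set_def)
    then show False by (auto simp: \<tau>_def split: if_splits)
  qed
  moreover have "inj_on (map_prod \<tau> \<tau>) (inversion_set S)"
    by (intro inj_onI) (metis (no_types, lifting) \<tau>\<tau> map_prod_simp prod.collapse prod.inject)
  ultimately show ?thesis
    using finite_inversion_set[OF S] by (simp add: card_image)
qed

lemma card_inversion_set_swap_01:
  assumes S: "S \<in> hybrid_confs" and x: "\<not> S x" "S (x + 1)"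
  shows "card (inversion_set S) = Suc (card (inversion_set (swap S x)))"
  using card_inversion_set_swap_10[OF swap_hybrid_confs[OF S], of x x] x by simp

text \<open>
  Moving one site to the right raises the difference of the two summands of the height by exactly one,
  so at some site \<open>x\<close> they agree. There the height is \<open>2 j\<close>, and the \<open>j\<close> 0's up to \<open>x\<close> form \<open>j\<^sup>2\<close>
  inversions with the \<open>j\<close> 1's beyond \<open>x\<close>.
\<close>

lemma ex_low_height:
  assumes S: "S \<in> hybrid_confs"
  shows "\<exists>x. (height_at S x)\<^sup>2 \<le> 4 * card (inversion_set S)"
proof -
  obtain a b where ab: "\<And>x. x \<le> a \<Longrightarrow> S x" "\<And>x. x \<ge> b \<Longrightarrow> \<not> S x"
    using S by (rule hybrid_confsE) blast
  define d where "d x = int (zeros_upto S x) - int (ones_beyond S x)" for x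
  have d: "d (x + 1) = d x + 1" for x
    using zeros_upto_Suc[OF S, of x] ones_beyond_Suc[OF S, of x] by (simp add: d_def)
  have d': "d (a + int n) = d a + int n" for n
  proof (induction n)
    case (Suc n)
    then show ?case using d[of "a + int n"] by (simp add: add_ac)
  qed simp
  have "{y. y \<le> a \<and> \<not> S y} = {}" using ab(1) by auto
  then have "zeros_upto S a = 0" by (simp only: zeros_upto_def card.empty)
  then have "d a = - int (ones_beyond S a)" by (simp add: d_def)
  then have "d (a + int (ones_beyond S a)) = 0" by (simp add: d')
  then obtain x where x: "zeros_upto S x = ones_beyond S x" by (auto simp: d_def)
  have "{y. y \<le> x \<and> \<not> S y} \<times> {y. x < y \<and> S y} \<subseteq> inversion_set S"
    by (auto simp: inversion_set_def)
  from card_mono[OF finite_inversion_set[OF S] this]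
  have "zeros_upto S x * ones_beyond S x \<le> card (inversion_set S)"
    by (simp add: card_cartesian_product zeros_upto_def ones_beyond_def)
  then have "(height_at S x)\<^sup>2 \<le> 4 * card (inversion_set S)"
    using x by (simp add: height_at_def power2_eq_square algebra_simps)
  then show ?thesis ..
qed

section \<open>The hybrid zone and its blocks\<close>

text \<open>
  The interval from the leftmost 0 to the rightmost 1, written so that it is empty for the ground state.
\<close>

definition zone :: "(int \<Rightarrow> bool) \<Rightarrow> int set" where
  "zone S = {x. (\<exists>y\<le>x. \<not> S y) \<and> (\<exists>y\<ge>x. S y)}"

lemma zone_extremes:
  assumes S: "S \<in> hybrid_confs"
  obtains l r where "\<not> S l" "\<And>y. \<not> S y \<Longrightarrow> l \<le> y" "S r" "\<And>y. S y \<Longrightarrow> y \<le> r"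
    "zone S = {l..r}"
proof -
  obtain a b where ab: "a \<le> b" "\<And>x. x \<le> a \<Longrightarrow> S x" "\<And>x. x \<ge> b \<Longrightarrow> \<not> S x"
    using S by (rule hybrid_confsE) blast
  have fin0: "finite {y. y \<le> b \<and> \<not> S y}" and fin1: "finite {y. a - 1 < y \<and> S y}"
    using finite_zeros_upto[OF S] finite_ones_beyond[OF S] by auto
  have ne0: "b \<in> {y. y \<le> b \<and> \<not> S y}" and ne1: "a \<in> {y. a - 1 < y \<and> S y}"
    using ab by auto
  define l where "l = Min {y. y \<le> b \<and> \<not> S y}"
  define r where "r = Max {y. a - 1 < y \<and> S y}"
  have l1: "\<not> S l" using Min_in[OF fin0] ne0 unfolding l_def by blast
  have r1: "S r" using Max_in[OF fin1] ne1 unfolding r_def by blast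
  have "l \<le> b" "a \<le> r"
    using Min_le[OF fin0 ne0] Max_ge[OF fin1 ne1] by (auto simp: l_def r_def)
  have l2: "l \<le> y" if "\<not> S y" for y
    using Min_le[OF fin0, of y] that \<open>l \<le> b\<close> by (cases "y \<le> b") (auto simp: l_def)
  have r2: "y \<le> r" if "S y" for y
    using Max_ge[OF fin1, of y] that \<open>a \<le> r\<close> by (cases "a \<le> y") (auto simp: r_def)
  have "zone S = {l..r}"
  proof (intro equalityI subsetI)
    fix x assume "x \<in> zone S"
    then obtain y z where "y \<le> x" "\<not> S y" "x \<le> z" "S z" by (auto simp: zone_def)
    then show "x \<in> {l..r}" using l2[of y] r2[of z] by simp
  next
    fix x assume "x \<in> {l..r}"
    then show "x \<in> zone S" using l1 r1 by (auto simp: zone_def)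
  qed
  then show ?thesis using that l1 l2 r1 r2 by blast
qed

lemma finite_zone: "S \<in> hybrid_confs \<Longrightarrow> finite (zone S)"
  by (erule zone_extremes) simp

text \<open>
  A maximal run of sites with a property ends where the property first fails; the next lemma is its
  mirror image.
\<close>

lemma ex_run_end:
  fixes x z :: int
  assumes "P x" "\<not> P z" "x < z"
  shows "\<exists>j\<ge>x. (\<forall>y\<in>{x..j}. P y) \<and> \<not> P (j + 1)"
proof -
  define n where "n = (LEAST n. \<not> P (x + int n))"
  have ex: "\<not> P (x + int (nat (z - x)))" using assms by simp
  have n: "\<not> P (x + int n)" unfolding n_def by (rule LeastI[of "\<lambda>n. \<not> P (x + int n)"]) (rule ex)
  have less: "P (x + int m)" if "m < n" for m
    using not_less_Least[of m "\<lambda>n. \<not> P (x + int n)"] that by (simp add: n_def)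
  have "n > 0" using n assms(1) by (cases n) auto
  have "P y" if "y \<in> {x..x + int n - 1}" for y
    using less[of "nat (y - x)"] that by auto
  then show ?thesis using n \<open>n > 0\<close> by (intro exI[of _ "x + int n - 1"]) auto
qed

lemma ex_run_start:
  fixes x z :: int
  assumes "P x" "\<not> P z" "z < x"
  shows "\<exists>i\<le>x. (\<forall>y\<in>{i..x}. P y) \<and> \<not> P (i - 1)"
proof -
  obtain j where j: "- x \<le> j" "\<forall>y\<in>{- x..j}. P (- y)" "\<not> P (- (j + 1))"
    using ex_run_end[of "\<lambda>y. P (- y)" "- x" "- z"] assms by auto
  have "P y" if "y \<in> {- j..x}" for y using j(2)[rule_format, of "- y"] that by auto
  with j show ?thesis by (intro exI[of _ "- j"]) auto
qed

lemma Union_finite_blocks: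
  assumes S: "S \<in> hybrid_confs"
  shows "\<Union>(finite_blocks a S) = {x \<in> zone S. S x = a}"
proof (intro equalityI subsetI)
  fix x assume "x \<in> \<Union>(finite_blocks a S)"
  then obtain i j where ij: "x \<in> {i..j}" "\<forall>x\<in>{i..j}. S x = a" "S (i - 1) \<noteq> a" "S (j + 1) \<noteq> a"
    unfolding finite_blocks_def by fast
  then have "S x = a" "i - 1 \<le> x" "j + 1 \<ge> x" by auto
  then show "x \<in> {x \<in> zone S. S x = a}"
    using ij(3,4) by (auto simp: zone_def)
next
  fix x assume "x \<in> {x \<in> zone S. S x = a}"
  then have x: "x \<in> zone S" "S x = a" by auto
  obtain c b where cb: "c \<le> b" "\<And>x. x \<le> c \<Longrightarrow> S x" "\<And>x. x \<ge> b \<Longrightarrow> \<not> S x"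
    using S by (rule hybrid_confsE) blast
  have "\<exists>z<x. S z \<noteq> a"
  proof (cases a)
    case True
    then show ?thesis using x by (auto simp: zone_def le_less)
  next
    case False
    have "S (min c x - 1)" using cb(2) by simp
    with False show ?thesis by (intro exI[of _ "min c x - 1"]) auto
  qed
  moreover have "\<exists>z>x. S z \<noteq> a"
  proof (cases a)
    case False
    then show ?thesis using x by (auto simp: zone_def le_less)
  next
    case True
    have "\<not> S (max b x + 1)" using cb(3) by simp
    with True show ?thesis by (intro exI[of _ "max b x + 1"]) auto
  qed
  ultimately obtain i j where
    "i \<le> x" "\<forall>y\<in>{i..x}. S y = a" "S (i - 1) \<noteq> a"
    "x \<le> j" "\<forall>y\<in>{x..j}. S y = a" "S (j + 1) \<noteq> a"
    using ex_run_start[of "\<lambda>y. S y = a" x] ex_run_end[of "\<lambda>y. S y = a" x] x(2) by metis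
  moreover from this have "\<forall>y\<in>{i..j}. S y = a" by (metis atLeastAtMost_iff linear)
  ultimately have "{i..j} \<in> finite_blocks a S" "x \<in> {i..j}"
    unfolding finite_blocks_def by auto
  then show "x \<in> \<Union>(finite_blocks a S)" by blast
qed

lemma disjoint_finite_blocks: "disjoint (finite_blocks a S)"
proof (rule disjointI, rule ccontr)
  fix B B' assume B: "B \<in> finite_blocks a S" "B' \<in> finite_blocks a S" "B \<noteq> B'" "B \<inter> B' \<noteq> {}"
  obtain i j where ij: "B = {i..j}" "\<forall>x\<in>{i..j}. S x = a" "S (i - 1) \<noteq> a" "S (j + 1) \<noteq> a"
    using B(1) unfolding finite_blocks_def by blast
  obtain k l where kl: "B' = {k..l}" "\<forall>x\<in>{k..l}. S x = a" "S (k - 1) \<noteq> a" "S (l + 1) \<noteq> a"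
    using B(2) unfolding finite_blocks_def by blast
  obtain x where x: "x \<in> {i..j}" "x \<in> {k..l}" using B(4) unfolding ij(1) kl(1) by blast
  have "i - 1 \<notin> {k..l}" "j + 1 \<notin> {k..l}" "k - 1 \<notin> {i..j}" "l + 1 \<notin> {i..j}"
    using ij kl by auto
  with x have "i = k" "j = l" by auto
  with B(3) ij kl show False by simp
qed

text \<open>
  The finite blocks are disjoint and cover the zone. Thus the size of the hybrid zone becomes a plain
  cardinality, and no individual block has to be followed through a move.
\<close>

lemma sum_card_finite_blocks:
  assumes S: "S \<in> hybrid_confs"
  shows "(\<Sum>B\<in>finite_blocks a S. card B) = card {x \<in> zone S. S x = a}"
  unfolding Union_finite_blocks[OF S, symmetric]
  by (rule card_Union_disjoint[symmetric])
     (use disjoint_finite_blocks[of a S] in \<open>auto simp: finite_blocks_def disjoint_def pairwise_def disjnt_def\<close>)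

lemma card_zone:
  assumes S: "S \<in> hybrid_confs"
  shows "card (zone S) = card {x \<in> zone S. \<not> S x} + card {x \<in> zone S. S x}"
proof -
  have "zone S = {x \<in> zone S. \<not> S x} \<union> {x \<in> zone S. S x}" by auto
  then have "card (zone S) = card ({x \<in> zone S. \<not> S x} \<union> {x \<in> zone S. S x})" by simp
  also have "\<dots> = card {x \<in> zone S. \<not> S x} + card {x \<in> zone S. S x}"
    using finite_zone[OF S] by (intro card_Un_disjoint) auto
  finally show ?thesis .
qed

lemma inversions_le_zone:
  assumes S: "S \<in> hybrid_confs"
  shows "4 * card (inversion_set S) \<le> (card (zone S))\<^sup>2"
proof -
  let ?A = "{x \<in> zone S. \<not> S x}" and ?B = "{x \<in> zone S. S x}"
  have "inversion_set S \<subseteq> ?A \<times> ?B"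
    by (auto simp: inversion_set_def zone_def intro: less_imp_le)
  then have "card (inversion_set S) \<le> card (?A \<times> ?B)"
    using finite_zone[OF S] by (intro card_mono) auto
  then have "card (inversion_set S) \<le> card ?A * card ?B" by (simp add: card_cartesian_product)
  moreover have "4 * (a * b) \<le> (a + b)\<^sup>2" for a b :: nat
  proof -
    have "0 \<le> (int a - int b)\<^sup>2" by simp
    then have "int (4 * (a * b)) \<le> int ((a + b)\<^sup>2)"
      by (simp add: power2_eq_square algebra_simps)
    then show ?thesis by (simp only: of_nat_le_iff)
  qed
  ultimately show ?thesis
    unfolding card_zone[OF S] by (meson le_trans mult_le_mono2)
qed

text \<open>
  Each finite 1-block is preceded by a pair 01, and for two such pairs \<open>x \<le> y\<close> the 0 at \<open>x\<close> and the 1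
  at \<open>y + 1\<close> form an inversion. The ordered couples \<open>x \<le> y\<close> make up at least half of all couples.
\<close>

lemma num_blocks_le_inversions:
  assumes S: "S \<in> hybrid_confs"
  shows "(card (finite_blocks True S))\<^sup>2 \<le> 2 * card (inversion_set S)"
proof -
  define U where "U = {x. \<not> S x \<and> S (x + 1)}"
  define A where "A = {(x, y) \<in> U \<times> U. x \<le> y}"
  have "U \<subseteq> unlike_pairs S" by (auto simp: U_def unlike_pairs_def)
  then have fin: "finite U" using unlike_pairs_finite_nonempty(1)[OF S] finite_subset by blast
  have finA: "finite A" by (rule finite_subset[of _ "U \<times> U"]) (auto simp: A_def fin)
  have "finite_blocks True S \<subseteq> (\<lambda>x. THE B. B \<in> finite_blocks True S \<and> x + 1 \<in> B) ` U"
  proof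
    fix B assume B: "B \<in> finite_blocks True S"
    then obtain i j where ij: "B = {i..j}" "i \<le> j" "\<forall>x\<in>{i..j}. S x = True" "S (i - 1) \<noteq> True"
      unfolding finite_blocks_def by fast
    have iB: "i - 1 + 1 \<in> B" using ij(1,2) by simp
    have uniq: "B' = B" if "B' \<in> finite_blocks True S" "i - 1 + 1 \<in> B'" for B'
      using disjointD[OF disjoint_finite_blocks that(1) B] that(2) iB by blast
    have "B = (THE B. B \<in> finite_blocks True S \<and> i - 1 + 1 \<in> B)"
      by (rule the_equality[symmetric]) (use B iB uniq in blast)+
    moreover have "i - 1 \<in> U" using ij by (auto simp: U_def)
    ultimately show "B \<in> (\<lambda>x. THE B. B \<in> finite_blocks True S \<and> x + 1 \<in> B) ` U"
      by (rule image_eqI)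
  qed
  from surj_card_le[OF fin this] have "card (finite_blocks True S) \<le> card U" .
  then have "(card (finite_blocks True S))\<^sup>2 \<le> card (U \<times> U)"
    by (simp add: card_cartesian_product power2_eq_square mult_le_mono)
  also have "U \<times> U = A \<union> prod.swap ` A"
  proof (intro equalityI subsetI)
    fix z assume z: "z \<in> U \<times> U"
    show "z \<in> A \<union> prod.swap ` A"
      by (cases "fst z \<le> snd z")
         (use z in \<open>auto simp: A_def intro!: image_eqI[of _ prod.swap "prod.swap z"]\<close>)
  qed (auto simp: A_def)
  also have "card \<dots> \<le> card A + card (prod.swap ` A)" by (rule card_Un_le)
  also have "card (prod.swap ` A) \<le> card A" using finA by (rule card_image_le)
  also have "card A \<le> card (inversion_set S)"
  proof (rule card_inj_on_le[of "\<lambda>(x, y). (x, y + 1)"])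
    show "(\<lambda>(x, y). (x, y + 1)) ` A \<subseteq> inversion_set S"
      by (auto simp: A_def U_def inversion_set_def)
  qed (auto simp: inj_on_def finite_inversion_set[OF S])
  finally show ?thesis by simp
qed

text \<open>
  Only the pairs 10 that straddle the two ends of the zone enlarge it. The value 2 is attained in the
  ground state, where the two ends coincide and a single move creates a zone of size two.
\<close>

lemma card_zone_swap:
  assumes S: "S \<in> hybrid_confs"
  obtains e1 e2 where "S e1" "\<not> S (e1 + 1)" "S e2" "\<not> S (e2 + 1)"
    "\<And>x. S x \<noteq> S (x + 1) \<Longrightarrow>
       card (zone (swap S x)) \<le> card (zone S) + (if x \<in> {e1, e2} then 2 else 0)"
proof -
  obtain l r where l: "\<not> S l" "\<And>y. \<not> S y \<Longrightarrow> l \<le> y"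
    and r: "S r" "\<And>y. S y \<Longrightarrow> y \<le> r" and z: "zone S = {l..r}"
    using S by (rule zone_extremes) blast
  have ends: "S (l - 1)" "\<not> S (r + 1)"
    using l(2)[of "l - 1"] r(2)[of "r + 1"] by auto
  have "card (zone (swap S x)) \<le> card (zone S) + (if x \<in> {l - 1, r} then 2 else 0)"
    if x: "S x \<noteq> S (x + 1)" for x
  proof -
    have T0: "l \<le> y \<or> y = x \<and> x = l - 1" if "\<not> swap S x y" for y
      using that l(2)[of y] l(2)[of "x + 1"] l(2)[of x]
      by (auto simp: swap_def split: if_splits)
    have T1: "y \<le> r \<or> y = x + 1 \<and> x = r" if "swap S x y" for y
      using that r(2)[of y] r(2)[of "x + 1"] r(2)[of x] x
      by (auto simp: swap_def split: if_splits)
    have sub: "zone (swap S x) \<subseteq> {(if x = l - 1 then l - 1 else l)..(if x = r then r + 1 else r)}"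
      using T0 T1 by (fastforce simp: zone_def)
    have "card (zone (swap S x)) \<le> card {(if x = l - 1 then l - 1 else l)..(if x = r then r + 1 else r)}"
      by (rule card_mono[OF _ sub]) simp
    also have "\<dots> \<le> card (zone S) + (if x \<in> {l - 1, r} then 2 else 0)"
      by (auto simp: z)
    finally show ?thesis .
  qed
  with ends l(1) r(1) show ?thesis using that[of "l - 1" r] by simp
qed

text \<open>
  From left to right the labels change from 1 to 0 once more often than from 0 to 1: a telescoping sum.
\<close>

lemma card_unlike_pairs:
  assumes S: "S \<in> hybrid_confs"
  shows "card {x \<in> unlike_pairs S. \<not> S x} \<le> card {x \<in> unlike_pairs S. S x}"
proof -
  obtain a b where ab: "a \<le> b" "\<And>x. x \<le> a \<Longrightarrow> S x" "\<And>x. x \<ge> b \<Longrightarrow> \<not> S x"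
    using S by (rule hybrid_confsE) blast
  have U: "unlike_pairs S \<subseteq> {a..b}"
  proof
    fix x assume x: "x \<in> unlike_pairs S"
    then show "x \<in> {a..b}"
      using ab(2)[of x] ab(2)[of "x + 1"] ab(3)[of x] ab(3)[of "x + 1"]
      by (cases "x < a"; cases "b < x") (auto simp: unlike_pairs_def)
  qed
  have tele: "(\<Sum>x\<in>{a..a + int n}. of_bool (S x) - of_bool (S (x + 1))) = of_bool (S a) - (of_bool (S (a + int n + 1)) :: int)" for n
  proof (induction n)
    case (Suc n)
    have "{a..a + int (Suc n)} = insert (a + int n + 1) {a..a + int n}" by auto
    then show ?case using Suc by (simp add: add_ac)
  qed simp
  have fin: "finite (unlike_pairs S)" by (rule unlike_pairs_finite_nonempty(1)[OF S])
  have "int (card {x \<in> unlike_pairs S. S x}) - int (card {x \<in> unlike_pairs S. \<not> S x}) =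
     (\<Sum>x\<in>unlike_pairs S. of_bool (S x)) - (\<Sum>x\<in>unlike_pairs S. of_bool (\<not> S x))"
    using fin by (simp add: of_bool_def sum.If_cases Int_def)
  also have "\<dots> = (\<Sum>x\<in>unlike_pairs S. of_bool (S x) - of_bool (S (x + 1)))"
    unfolding sum_subtractf[symmetric] by (rule sum.cong) (auto simp: unlike_pairs_def)
  also have "\<dots> = (\<Sum>x\<in>{a..b}. of_bool (S x) - of_bool (S (x + 1)))"
    by (rule sum.mono_neutral_left) (use U in \<open>auto simp: unlike_pairs_def\<close>)
  also have "\<dots> = 1" using tele[of "nat (b - a)"] ab by simp
  finally show ?thesis by linarith
qed

section \<open>Drift of the exponential functionals\<close>

definition swap_prob :: "real \<Rightarrow> (int \<Rightarrow> bool) \<Rightarrow> int \<Rightarrow> real" where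
  "swap_prob p S x = (if S x then 1 - p else p)"

text \<open>
  The discrete Hopf--Cole transform of the height, viewed as a growing interface, summed over all sites.
\<close>

definition height_sum :: "real \<Rightarrow> (int \<Rightarrow> bool) \<Rightarrow> real" where
  "height_sum v S = (\<Sum>\<^sub>\<infinity>x. v ^ height_at S x)"

text \<open>
  Far to the right the 0's accumulate and far to the left the 1's, one per site, so the height sum is
  dominated by a geometric series.
\<close>

lemma abs_le_height_at:
  assumes S: "S \<in> hybrid_confs"
  obtains k where "\<And>x. nat \<bar>x\<bar> \<le> height_at S x + k"
proof -
  obtain a b where ab: "a \<le> b" "\<And>x. x \<le> a \<Longrightarrow> S x" "\<And>x. x \<ge> b \<Longrightarrow> \<not> S x"
    using S by (rule hybrid_confsE) blast
  have "nat \<bar>x\<bar> \<le> height_at S x + (nat \<bar>a\<bar> + nat \<bar>b\<bar>)" for x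
  proof -
    have "card {b..x} \<le> zeros_upto S x" unfolding zeros_upto_def
      by (rule card_mono[OF finite_zeros_upto[OF S]]) (use ab in auto)
    moreover have "card {x + 1..a} \<le> ones_beyond S x" unfolding ones_beyond_def
      by (rule card_mono[OF finite_ones_beyond[OF S]]) (use ab in auto)
    ultimately show ?thesis by (simp add: height_at_def)
  qed
  then show ?thesis by (rule that)
qed

lemma summable_on_power_abs_int:
  assumes "0 < v" "v < (1::real)"
  shows "(\<lambda>x::int. v ^ nat \<bar>x\<bar>) summable_on UNIV"
proof -
  have g: "(\<lambda>n. v ^ n) summable_on UNIV"
    using assms by (intro norm_summable_imp_summable_on) (simp add: power_abs summable_geometric)
  have "(\<lambda>x. v ^ nat \<bar>x\<bar>) summable_on (range int)"
    by (subst summable_on_reindex) (use g in \<open>auto simp: o_def\<close>)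
  moreover have "(\<lambda>x. v ^ nat \<bar>x\<bar>) summable_on (range (\<lambda>n. - int n))"
    by (subst summable_on_reindex) (use g in \<open>auto simp: o_def inj_on_def\<close>)
  ultimately have "(\<lambda>x. v ^ nat \<bar>x\<bar>) summable_on (range int \<union> range (\<lambda>n. - int n))"
    by (rule summable_on_union)
  also have "range int \<union> range (\<lambda>n. - int n) = UNIV"
    by (auto simp: image_iff) (metis int_cases2)
  finally show ?thesis .
qed

lemma summable_on_height:
  fixes v :: real
  assumes S: "S \<in> hybrid_confs" and v: "0 < v" "v < 1"
  shows "(\<lambda>x. v ^ height_at S x) summable_on UNIV"
proof -
  obtain k where k: "\<And>x. nat \<bar>x\<bar> \<le> height_at S x + k"
    using S by (rule abs_le_height_at) blast
  have "(\<lambda>x. inverse (v ^ k) * v ^ nat \<bar>x\<bar>) summable_on UNIV"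
    by (intro summable_on_cmult_right summable_on_power_abs_int v)
  then show ?thesis
  proof (rule summable_on_comparison_test)
    fix x
    have "v ^ (height_at S x + k) \<le> v ^ nat \<bar>x\<bar>"
      using k v by (intro power_decreasing) auto
    then show "v ^ height_at S x \<le> inverse (v ^ k) * v ^ nat \<bar>x\<bar>"
      using v by (simp add: power_add field_simps)
  qed (use v in simp)
qed

lemma height_sum_ge:
  assumes S: "S \<in> hybrid_confs" and v: "0 < v" "v < 1"
  shows "v ^ height_at S x \<le> height_sum v S"
  using finite_sum_le_infsum[OF summable_on_height[OF S v], of "{x}"] v
  by (simp add: height_sum_def)

lemma height_sum_pos:
  assumes S: "S \<in> hybrid_confs" and v: "0 < v" "v < 1"
  shows "0 < height_sum v S"
  using height_sum_ge[OF S v, of 0] zero_less_power[OF v(1), of "height_at S 0"] by linarith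

lemma height_sum_swap:
  assumes S: "S \<in> hybrid_confs" and x: "S x \<noteq> S (x + 1)" and v: "0 < v" "v < 1"
  shows "height_sum v (swap S x) - height_sum v S =
    ((if S x then v\<^sup>2 else 1 / v\<^sup>2) - 1) * v ^ height_at S x"
proof -
  let ?T = "swap S x"
  have "height_sum v ?T = infsum (\<lambda>w. v ^ height_at S w +
      (if w = x then v ^ height_at ?T x - v ^ height_at S x else 0)) UNIV"
    unfolding height_sum_def using x
    by (intro infsum_cong, cases "S x")
       (auto simp: height_swap_10[OF S, of x] height_swap_01[OF S, of x])
  also have "\<dots> = height_sum v S +
      infsum (\<lambda>w. if w = x then v ^ height_at ?T x - v ^ height_at S x else 0) UNIV"
    unfolding height_sum_def
    by (intro infsum_add summable_on_height S v finite_nonzero_values_imp_summable_on) auto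
  also have "infsum (\<lambda>w. if w = x then v ^ height_at ?T x - v ^ height_at S x else 0) UNIV =
      infsum (\<lambda>w. v ^ height_at ?T x - v ^ height_at S x) {x}"
    by (rule infsum_cong_neutral) auto
  finally have *: "height_sum v ?T - height_sum v S = v ^ height_at ?T x - v ^ height_at S x"
    by simp
  show ?thesis
  proof (cases "S x")
    case True
    then show ?thesis using * x v
      by (simp add: height_swap_10[OF S, of x] power_add algebra_simps power2_eq_square)
  next
    case False
    then have "v ^ height_at S x = v ^ height_at ?T x * v\<^sup>2"
      using x by (simp add: height_swap_01[OF S, of x] power_add power2_eq_square)
    then have "v ^ height_at ?T x = v ^ height_at S x / v\<^sup>2" using v by simp
    then show ?thesis using * False by (simp add: algebra_simps)
  qed
qed

text \<open>
  The move at an unlike pair changes the term at this site only. Its expected change, as a function of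
  the site, is bounded by a discrete heat operator applied to the terms \<open>Z x = v\<^bsup>height x\<^esup>\<close>, namely by
  \<open>(1 - p) v (Z (x + 1) + Z (x - 1)) - (1 - p) (v\<^sup>2 + 1) Z x\<close>. This is an equality at pairs 10, and both
  sides vanish where two adjacent labels agree; at pairs 01 it is the assumption \<open>p \<le> (1 - p) v\<^sup>2\<close>. Summation over all
  sites removes the shifts and leaves the factor \<open>2 v - (v\<^sup>2 + 1) = - (1 - v)\<^sup>2\<close>.
\<close>

lemma height_sum_drift:
  assumes S: "S \<in> hybrid_confs" and v: "0 < v" "v < 1"
    and p: "0 \<le> p" "p \<le> (1 - p) * v\<^sup>2"
  shows "(\<Sum>x\<in>unlike_pairs S. swap_prob p S x * (height_sum v (swap S x) - height_sum v S))
    \<le> - ((1 - p) * (1 - v)\<^sup>2) * height_sum v S"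
proof -
  let ?U = "unlike_pairs S" and ?Z = "\<lambda>x. v ^ height_at S x"
  define k where "k x = (if x \<in> ?U then
    swap_prob p S x * (((if S x then v\<^sup>2 else 1 / v\<^sup>2) - 1) * ?Z x) else 0)" for x
  have fin: "finite ?U" by (rule unlike_pairs_finite_nonempty(1)[OF S])
  have sumZ: "?Z summable_on UNIV" by (rule summable_on_height[OF S v])
  have shift: "(\<lambda>x. ?Z (x + d)) summable_on UNIV \<and> infsum (\<lambda>x. ?Z (x + d)) UNIV = height_sum v S" for d
  proof -
    have b: "bij_betw (\<lambda>x. x + d) UNIV UNIV"
      by (rule bij_betwI[of _ _ _ "\<lambda>x. x - d"]) auto
    show ?thesis
      using summable_on_reindex_bij_betw[OF b, of ?Z] infsum_reindex_bij_betw[OF b, of ?Z] sumZ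
      by (simp add: height_sum_def)
  qed
  \<comment> \<open>comparison with the heat operator, site by site\<close>
  have pw: "k x \<le> (1 - p) * v * (?Z (x + 1) + ?Z (x + (- 1))) - (1 - p) * (v\<^sup>2 + 1) * ?Z x" for x
  proof -
    have hl: "S x \<Longrightarrow> ?Z (x - 1) = v * ?Z x" "\<not> S x \<Longrightarrow> ?Z x = v * ?Z (x - 1)"
      using height_Suc[OF S, of "x - 1"] by auto
    have hr: "S (x + 1) \<Longrightarrow> ?Z x = v * ?Z (x + 1)" "\<not> S (x + 1) \<Longrightarrow> ?Z (x + 1) = v * ?Z x"
      using height_Suc[OF S, of "x"] by auto
    define z where "z = ?Z x"
    define zl where "zl = ?Z (x - 1)"
    define zr where "zr = ?Z (x + 1)"
    have z0: "z > 0" using v by (simp add: z_def)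
    have zz: "S x \<Longrightarrow> zl = v * z" "\<not> S x \<Longrightarrow> zl = z / v"
       "S (x + 1) \<Longrightarrow> zr = z / v" "\<not> S (x + 1) \<Longrightarrow> zr = v * z"
      using hl hr v by (simp_all add: z_def zl_def zr_def)
    have kx: "k x = (if S x = S (x + 1) then 0 else
        swap_prob p S x * (((if S x then v\<^sup>2 else 1 / v\<^sup>2) - 1) * z))"
      by (simp add: k_def unlike_pairs_def z_def)
    have "k x \<le> (1 - p) * v * (zr + zl) - (1 - p) * (v\<^sup>2 + 1) * z"
    proof (cases "S x"; cases "S (x + 1)")
      assume "S x" "S (x + 1)"
      then show ?thesis using v by (simp add: kx zz field_simps power2_eq_square)
    next
      assume "S x" "\<not> S (x + 1)"
      then show ?thesis by (simp add: kx zz swap_prob_def field_simps power2_eq_square)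
    next
      assume *: "\<not> S x" "S (x + 1)"
      have "p * (1 / v\<^sup>2 - 1) \<le> (1 - p) * v\<^sup>2 * (1 / v\<^sup>2 - 1)"
        using p v by (intro mult_right_mono) (auto simp: field_simps power_le_one)
      also have "\<dots> = (1 - p) * (1 - v\<^sup>2)" using v by (simp add: field_simps)
      finally have "p * (1 / v\<^sup>2 - 1) * z \<le> (1 - p) * (1 - v\<^sup>2) * z"
        using z0 by (intro mult_right_mono) auto
      also have "\<dots> = (1 - p) * v * (zr + zl) - (1 - p) * (v\<^sup>2 + 1) * z"
        using * v by (simp add: zz field_simps power2_eq_square)
      finally show ?thesis using * by (simp add: kx swap_prob_def mult_ac)
    next
      assume "\<not> S x" "\<not> S (x + 1)"
      then show ?thesis using v by (simp add: kx zz field_simps power2_eq_square)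
    qed
    then show ?thesis by (simp add: z_def zl_def zr_def)
  qed
  have "(\<Sum>x\<in>?U. swap_prob p S x * (height_sum v (swap S x) - height_sum v S)) = (\<Sum>x\<in>?U. k x)"
    by (rule sum.cong) (auto simp: k_def unlike_pairs_def height_sum_swap[OF S _ v])
  also have "\<dots> = infsum k ?U" using fin by simp
  also have "\<dots> = infsum k UNIV" by (rule infsum_cong_neutral) (auto simp: k_def)
  also have "\<dots> \<le> infsum (\<lambda>x. (1 - p) * v * (?Z (x + 1) + ?Z (x + (- 1))) +
      (- ((1 - p) * (v\<^sup>2 + 1))) * ?Z x) UNIV"
  proof (rule infsum_mono)
    show "k summable_on UNIV"
      by (rule finite_nonzero_values_imp_summable_on, rule finite_subset[OF _ fin]) (auto simp: k_def)
    show "(\<lambda>x. (1 - p) * v * (?Z (x + 1) + ?Z (x + (- 1))) +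
      (- ((1 - p) * (v\<^sup>2 + 1))) * ?Z x) summable_on UNIV"
      using shift[of 1] shift[of "- 1"] sumZ by (intro summable_on_add summable_on_cmult_right) auto
    show "k x \<le> (1 - p) * v * (?Z (x + 1) + ?Z (x + (- 1))) +
      (- ((1 - p) * (v\<^sup>2 + 1))) * ?Z x" for x
      using pw[of x] by (simp only: mult_minus_left add_uminus_conv_diff)
  qed
  also have "\<dots> = (1 - p) * v * (height_sum v S + height_sum v S) + (- ((1 - p) * (v\<^sup>2 + 1))) * height_sum v S"
  proof -
    have "infsum (\<lambda>x. ?Z (x + 1) + ?Z (x + (- 1))) UNIV = height_sum v S + height_sum v S"
      using shift[of 1] shift[of "- 1"] by (simp add: infsum_add)
    moreover have "(\<lambda>x. (1 - p) * v * (?Z (x + 1) + ?Z (x + (- 1)))) summable_on UNIV"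
      using shift[of 1] shift[of "- 1"] by (intro summable_on_cmult_right summable_on_add) auto
    moreover have "(\<lambda>x. (- ((1 - p) * (v\<^sup>2 + 1))) * ?Z x) summable_on UNIV"
      by (intro summable_on_cmult_right sumZ)
    ultimately show ?thesis
      by (simp only: infsum_add infsum_cmult_right' height_sum_def)
  qed
  also have "\<dots> = - ((1 - p) * (1 - v)\<^sup>2) * height_sum v S"
    by (simp add: algebra_simps power2_eq_square)
  finally show ?thesis .
qed

text \<open>
  At most two unlike pairs enlarge the zone, each costing a factor of at most \<open>u\<^sup>2\<close>. The loss of
  the height sum, which is proportional to the height sum itself, pays for both when \<open>u\<close> is close
  to 1. No division by the number of unlike pairs occurs: the loss and the cost are both sums over them.
\<close>

lemma zone_height_sum_drift:
  assumes S: "S \<in> hybrid_confs" and v: "0 < v" "v < 1"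
    and p: "0 \<le> p" "p \<le> 1" "p \<le> (1 - p) * v\<^sup>2"
    and u: "1 \<le> u" "2 * (u\<^sup>2 - 1) \<le> (1 - p) * (1 - v)\<^sup>2"
  defines "W \<equiv> \<lambda>T. u ^ card (zone T) * height_sum v T"
  shows "(\<Sum>x\<in>unlike_pairs S. swap_prob p S x * (W (swap S x) - W S)) \<le> 0"
proof -
  let ?U = "unlike_pairs S" and ?H = "height_sum v"
  obtain e1 e2 where e: "S e1" "\<not> S (e1 + 1)" "S e2" "\<not> S (e2 + 1)" and
    grow: "\<And>x. S x \<noteq> S (x + 1) \<Longrightarrow>
       card (zone (swap S x)) \<le> card (zone S) + (if x \<in> {e1, e2} then 2 else 0)"
    using S by (rule card_zone_swap) blast
  have fin: "finite ?U" by (rule unlike_pairs_finite_nonempty(1)[OF S])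
  have H0: "0 < ?H S" by (rule height_sum_pos[OF S v])
  have step: "swap_prob p S x * (W (swap S x) - W S) \<le>
      u ^ card (zone S) * (swap_prob p S x * (?H (swap S x) - ?H S))
      + u ^ card (zone S) * ((u\<^sup>2 - 1) * ?H S) * of_bool (x \<in> {e1, e2})" if x: "x \<in> ?U" for x
  proof -
    have x': "S x \<noteq> S (x + 1)" using x by (simp add: unlike_pairs_def)
    have H': "0 < ?H (swap S x)" by (intro height_sum_pos swap_hybrid_confs S v)
    have r: "0 \<le> swap_prob p S x" "swap_prob p S x \<le> 1" using p by (auto simp: swap_prob_def)
    show ?thesis
    proof (cases "x \<in> {e1, e2}")
      case True
      then have "S x" using e by auto
      have "v\<^sup>2 - 1 \<le> 0" using v by (simp add: power_le_one)
      then have "?H (swap S x) - ?H S \<le> 0"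
        unfolding height_sum_swap[OF S x' v] using \<open>S x\<close> v by (simp add: mult_nonpos_nonneg)
      then have le: "?H (swap S x) \<le> ?H S" by simp
      have "W (swap S x) \<le> u ^ (card (zone S) + 2) * ?H (swap S x)"
        unfolding W_def using grow[OF x'] True H' u
        by (intro mult_right_mono power_increasing) auto
      also have "\<dots> = u ^ card (zone S) * ?H (swap S x)
          + u ^ card (zone S) * ((u\<^sup>2 - 1) * ?H (swap S x))"
        by (simp add: power_add algebra_simps power2_eq_square)
      also have "\<dots> \<le> u ^ card (zone S) * ?H (swap S x) + u ^ card (zone S) * ((u\<^sup>2 - 1) * ?H S)"
        using le u by (intro add_left_mono mult_left_mono) auto
      finally have "W (swap S x) - W S \<le> u ^ card (zone S) * (?H (swap S x) - ?H S)
          + u ^ card (zone S) * ((u\<^sup>2 - 1) * ?H S)"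
        by (simp add: W_def algebra_simps)
      from mult_left_mono[OF this r(1)]
      have "swap_prob p S x * (W (swap S x) - W S) \<le>
         u ^ card (zone S) * (swap_prob p S x * (?H (swap S x) - ?H S))
         + swap_prob p S x * (u ^ card (zone S) * ((u\<^sup>2 - 1) * ?H S))"
        by (simp only: distrib_left mult.left_commute)
      also have "swap_prob p S x * (u ^ card (zone S) * ((u\<^sup>2 - 1) * ?H S))
          \<le> 1 * (u ^ card (zone S) * ((u\<^sup>2 - 1) * ?H S))"
        using r u H0 by (intro mult_right_mono) auto
      finally show ?thesis using True by simp
    next
      case False
      have "W (swap S x) \<le> u ^ card (zone S) * ?H (swap S x)"
        unfolding W_def using grow[OF x'] False H' u
        by (intro mult_right_mono power_increasing) auto
      then have "W (swap S x) - W S \<le> u ^ card (zone S) * (?H (swap S x) - ?H S)"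
        by (simp add: W_def algebra_simps)
      from mult_left_mono[OF this r(1)] show ?thesis using False by (simp add: mult.left_commute)
    qed
  qed
  have "(\<Sum>x\<in>?U. swap_prob p S x * (W (swap S x) - W S)) \<le>
      (\<Sum>x\<in>?U. u ^ card (zone S) * (swap_prob p S x * (?H (swap S x) - ?H S))
      + u ^ card (zone S) * ((u\<^sup>2 - 1) * ?H S) * of_bool (x \<in> {e1, e2}))"
    by (rule sum_mono) (rule step)
  also have "\<dots> = u ^ card (zone S) * (\<Sum>x\<in>?U. swap_prob p S x * (?H (swap S x) - ?H S))
      + u ^ card (zone S) * ((u\<^sup>2 - 1) * ?H S) * (\<Sum>x\<in>?U. of_bool (x \<in> {e1, e2}))"
    by (simp only: sum.distrib sum_distrib_left)
  also have "\<dots> \<le> u ^ card (zone S) * (- ((1 - p) * (1 - v)\<^sup>2) * ?H S)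
      + u ^ card (zone S) * ((u\<^sup>2 - 1) * ?H S) * 2"
  proof (intro add_mono mult_left_mono)
    have "(\<Sum>x\<in>?U. of_bool (x \<in> {e1, e2})) = real (card (?U \<inter> {e1, e2}))"
      using fin by (simp add: of_bool_def sum.If_cases Int_def)
    also have "card (?U \<inter> {e1, e2}) \<le> card {e1, e2}" by (rule card_mono) auto
    also have "card {e1, e2} \<le> 2" by (simp add: card_insert_if)
    finally show "(\<Sum>x\<in>?U. of_bool (x \<in> {e1, e2})) \<le> (2::real)" by simp
  qed (use u H0 height_sum_drift[OF S v p(1) p(3)] in auto)
  also have "\<dots> = u ^ card (zone S) * ?H S * (2 * (u\<^sup>2 - 1) - (1 - p) * (1 - v)\<^sup>2)"
    by (simp add: algebra_simps)
  also have "\<dots> \<le> 0"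
    using u H0 by (intro mult_nonneg_nonpos) auto
  finally show ?thesis .
qed

text \<open>
  Each pair 10 gives the factor \<open>v\<close> with probability \<open>1 - p\<close> and each pair 01 the factor \<open>1 / v\<close> with
  probability \<open>p \<le> (1 - p) v\<^sup>2\<close>. As at least half of the unlike pairs are of the first kind, the loss is
  of the order of their total number, and the number cancels when a pair is chosen uniformly.
\<close>

lemma inversion_power_drift:
  assumes S: "S \<in> hybrid_confs" and v: "0 < v" "v < 1"
    and p: "0 \<le> p" "p \<le> 1" "p \<le> (1 - p) * v\<^sup>2"
  defines "G \<equiv> \<lambda>T. v ^ card (inversion_set T)"
  shows "(\<Sum>x\<in>unlike_pairs S. swap_prob p S x * (G (swap S x) - G S))
    \<le> - ((1 - p) * (1 - v)\<^sup>2 / 2) * real (card (unlike_pairs S)) * G S"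
proof -
  let ?U = "unlike_pairs S"
  let ?A = "{x \<in> ?U. S x}" and ?B = "{x \<in> ?U. \<not> S x}"
  have fin: "finite ?U" by (rule unlike_pairs_finite_nonempty(1)[OF S])
  have G0: "0 < G S" using v by (simp add: G_def)
  have "swap_prob p S x * (G (swap S x) - G S) \<le>
      G S * ((1 - p) * (1 - v)) * ((if S x then 0 else v) - (if S x then 1 else 0))" if x: "x \<in> ?U" for x
  proof (cases "S x")
    case True
    then show ?thesis using x
      by (simp add: unlike_pairs_def G_def swap_prob_def card_inversion_set_swap_10[OF S] algebra_simps)
  next
    case False
    then have "G S = v * G (swap S x)"
      using x by (simp add: unlike_pairs_def G_def card_inversion_set_swap_01[OF S, of x])
    then have "swap_prob p S x * (G (swap S x) - G S) = p * (1 / v - 1) * G S"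
      using False v by (simp add: swap_prob_def field_simps)
    also have "\<dots> \<le> (1 - p) * v\<^sup>2 * (1 / v - 1) * G S"
      using p v G0 by (intro mult_right_mono) auto
    also have "\<dots> = G S * ((1 - p) * (1 - v)) * v"
      using v by (simp add: field_simps power2_eq_square)
    finally show ?thesis using False by simp
  qed
  then have "(\<Sum>x\<in>?U. swap_prob p S x * (G (swap S x) - G S)) \<le>
     (\<Sum>x\<in>?U. G S * ((1 - p) * (1 - v)) * ((if S x then 0 else v) - (if S x then 1 else 0)))"
    by (rule sum_mono)
  also have "\<dots> = G S * ((1 - p) * (1 - v)) * (v * real (card ?B) - real (card ?A))"
    using fin by (simp add: sum_subtractf sum.If_cases Int_def flip: sum_distrib_left)
  also have "\<dots> \<le> G S * ((1 - p) * (1 - v)) * (- ((1 - v) * real (card ?U) / 2))"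
  proof (rule mult_left_mono)
    have "?U = ?A \<union> ?B" by auto
    then have "card ?U = card (?A \<union> ?B)" by simp
    also have "\<dots> = card ?A + card ?B" using fin by (intro card_Un_disjoint) auto
    finally have "card ?U = card ?A + card ?B" .
    moreover have "0 \<le> (1 + v) * (real (card ?A) - real (card ?B))"
      using card_unlike_pairs[OF S] v by simp
    ultimately show "v * real (card ?B) - real (card ?A) \<le> - ((1 - v) * real (card ?U) / 2)"
      by (simp add: field_simps)
  qed (use G0 p v in simp)
  also have "\<dots> = - ((1 - p) * (1 - v)\<^sup>2 / 2) * real (card (unlike_pairs S)) * G S"
    by (simp add: power2_eq_square)
  finally show ?thesis .
qed

section \<open>Passage to translation classes\<close>

lemma translate_equiv_refl: "S \<in> hybrid_confs \<Longrightarrow> translate_equiv S S"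
  using translate_equivI[of S 0] by simp

lemma config_cases:
  obtains S where "S \<in> hybrid_confs" "c = abs_config S"
proof
  show "c = abs_config (rep_config c)"
    by (rule Quotient_abs_rep[OF Quotient_config, symmetric])
  have "translate_equiv (rep_config c) (rep_config c)"
    by (rule Quotient_rep_reflp[OF Quotient_config])
  then show "rep_config c \<in> hybrid_confs" by (rule translate_equivE)
qed

lemma card_inversion_set_shift:
  "card (inversion_set (\<lambda>x. S (x + k))) = card (inversion_set S)"
proof -
  have "bij_betw (\<lambda>(x, y). (x + k, y + k)) (inversion_set (\<lambda>x. S (x + k))) (inversion_set S)"
    by (rule bij_betwI[of _ _ _ "\<lambda>(x, y). (x - k, y - k)"]) (auto simp: inversion_set_def)
  then show ?thesis by (rule bij_betw_same_card)
qed

lemma height_at_shift: "height_at (\<lambda>x. S (x + k)) x = height_at S (x + k)"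
proof -
  have "bij_betw (\<lambda>y. y + k) {y. y \<le> x \<and> \<not> S (y + k)} {y. y \<le> x + k \<and> \<not> S y}"
    by (rule bij_betwI[of _ _ _ "\<lambda>y. y - k"]) auto
  moreover have "bij_betw (\<lambda>y. y + k) {y. x < y \<and> S (y + k)} {y. x + k < y \<and> S y}"
    by (rule bij_betwI[of _ _ _ "\<lambda>y. y - k"]) auto
  ultimately show ?thesis
    by (simp add: height_at_def zeros_upto_def ones_beyond_def bij_betw_same_card)
qed

lemma height_sum_shift: "height_sum v (\<lambda>x. S (x + k)) = height_sum v S"
proof -
  have "bij_betw (\<lambda>x. x + k) UNIV UNIV"
    by (rule bij_betwI[of _ _ _ "\<lambda>x. x - k"]) auto
  from infsum_reindex_bij_betw[OF this, of "\<lambda>x. v ^ height_at S x"] show ?thesis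
    by (simp add: height_sum_def height_at_shift)
qed

lift_definition inversions :: "config \<Rightarrow> nat" is "\<lambda>S. card (inversion_set S)"
  by (erule translate_equivE) (simp only: card_inversion_set_shift)

lift_definition config_height_sum :: "real \<Rightarrow> config \<Rightarrow> real" is height_sum
  by (erule translate_equivE) (simp only: height_sum_shift)

lemma inversions_abs: "S \<in> hybrid_confs \<Longrightarrow> inversions (abs_config S) = card (inversion_set S)"
  by (rule inversions.abs_eq) (rule translate_equiv_refl)

lemma config_height_sum_abs:
  "S \<in> hybrid_confs \<Longrightarrow> config_height_sum v (abs_config S) = height_sum v S"
  by (rule config_height_sum.abs_eq) (rule translate_equiv_refl)

lemma zone_size_abs: "S \<in> hybrid_confs \<Longrightarrow> zone_size (abs_config S) = card (zone S)"
  by (simp add: zone_size.abs_eq[OF translate_equiv_refl] sum_card_finite_blocks card_zone)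

lemma num_blocks_abs: "S \<in> hybrid_confs \<Longrightarrow> num_blocks (abs_config S) = card (finite_blocks True S)"
  by (rule num_blocks.abs_eq) (rule translate_equiv_refl)

lemma num_blocks_le: "(num_blocks c)\<^sup>2 \<le> 2 * inversions c"
  by (cases c rule: config_cases) (simp add: num_blocks_abs inversions_abs num_blocks_le_inversions)

lemma zone_size_ge: "4 * inversions c \<le> (zone_size c)\<^sup>2"
  by (cases c rule: config_cases) (simp add: zone_size_abs inversions_abs inversions_le_zone)

lemma config_height_sum_pos: "0 < v \<Longrightarrow> v < 1 \<Longrightarrow> 0 < config_height_sum v c"
  by (cases c rule: config_cases) (simp add: config_height_sum_abs height_sum_pos)

lemma config_height_sum_ge:
  assumes "0 < v" "v < 1"
  obtains h where "h\<^sup>2 \<le> 4 * inversions c" "v ^ h \<le> config_height_sum v c"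
proof (cases c rule: config_cases)
  case (1 S)
  then obtain x where "(height_at S x)\<^sup>2 \<le> 4 * card (inversion_set S)"
    using ex_low_height by blast
  with 1 show ?thesis
    using height_sum_ge[OF 1(1) assms, of x]
    by (intro that[of "height_at S x"]) (simp_all add: inversions_abs config_height_sum_abs)
qed

section \<open>One exclusion step\<close>

lemma exclusion_step_abs:
  assumes S: "S \<in> hybrid_confs"
  shows "exclusion_voter_step 0 p (abs_config S) =
    bind_pmf (pmf_of_set (unlike_pairs S)) (\<lambda>x. map_pmf abs_config (exclusion_move p S x))"
proof -
  have "bernoulli_pmf 0 = return_pmf False"
    by (rule pmf_eqI) (case_tac i; simp)
  then show ?thesis
    by (simp add: exclusion_voter_step.abs_eq[OF translate_equiv_refl[OF S]] step_rep_def
        bind_return_pmf map_bind_pmf)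
qed

lemma exclusion_move_eq_swap:
  assumes "x \<in> unlike_pairs S"
  shows "exclusion_move p S x =
    map_pmf (\<lambda>b. if b then swap S x else S) (bernoulli_pmf (swap_prob p S x))"
proof -
  have "(if \<not> S x \<and> S (x + 1) then p else 1 - p) = swap_prob p S x"
    using assms by (auto simp: swap_prob_def unlike_pairs_def)
  then show ?thesis by (simp only: exclusion_move_def swap_def)
qed

lemma exclusion_step_cases:
  assumes S: "S \<in> hybrid_confs"
    and c: "c \<in> set_pmf (exclusion_voter_step 0 p (abs_config S))"
  obtains "c = abs_config S" | x where "x \<in> unlike_pairs S" "c = abs_config (swap S x)"
  using c unlike_pairs_finite_nonempty[OF S]
  by (auto simp: exclusion_step_abs[OF S] exclusion_move_eq_swap split: if_splits)

lemma inversions_step: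
  assumes "c' \<in> set_pmf (exclusion_voter_step 0 p c)"
  shows "inversions c' \<le> inversions c + 1"
proof (cases c rule: config_cases)
  case (1 S)
  show ?thesis
  proof (rule exclusion_step_cases[OF 1(1) assms[unfolded 1(2)]])
    assume "c' = abs_config S"
    then show ?thesis using 1 by simp
  next
    fix x assume x: "x \<in> unlike_pairs S" "c' = abs_config (swap S x)"
    then have "card (inversion_set (swap S x)) \<le> card (inversion_set S) + 1"
      using card_inversion_set_swap_10[OF 1(1), of x] card_inversion_set_swap_01[OF 1(1), of x]
      by (cases "S x") (auto simp: unlike_pairs_def)
    then show ?thesis
      using x 1 by (simp add: inversions_abs swap_hybrid_confs)
  qed
qed

text \<open>
  The passage from sums over unlike pairs to expectations: a pair is chosen uniformly, so a bound on
  the total drift is divided by the number of pairs.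
\<close>

lemma nn_integral_exclusion_step:
  assumes S: "S \<in> hybrid_confs" and p: "0 \<le> p" "p \<le> 1" and g: "\<And>c. 0 \<le> g c"
    and drift: "(\<Sum>x\<in>unlike_pairs S. swap_prob p S x * (g (abs_config (swap S x)) - g (abs_config S)))
      \<le> (r - 1) * real (card (unlike_pairs S)) * g (abs_config S)"
  shows "(\<integral>\<^sup>+c. ennreal (g c) \<partial>exclusion_voter_step 0 p (abs_config S)) \<le> ennreal (r * g (abs_config S))"
proof -
  let ?U = "unlike_pairs S" and ?g = "\<lambda>T. g (abs_config T)"
  note U = unlike_pairs_finite_nonempty[OF S]
  have cU: "0 < card ?U" using U by (simp add: card_gt_0_iff)
  have move: "(\<integral>\<^sup>+T. ennreal (?g T) \<partial>exclusion_move p S x) =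
      ennreal (?g S + swap_prob p S x * (?g (swap S x) - ?g S))" if x: "x \<in> ?U" for x
  proof -
    have r: "0 \<le> swap_prob p S x" "swap_prob p S x \<le> 1"
      using p by (auto simp: swap_prob_def)
    then have "(\<integral>\<^sup>+T. ennreal (?g T) \<partial>exclusion_move p S x) =
        ennreal (?g (swap S x)) * ennreal (swap_prob p S x) + ennreal (?g S) * ennreal (1 - swap_prob p S x)"
      by (simp add: exclusion_move_eq_swap[OF x])
    also have "\<dots> = ennreal (?g (swap S x) * swap_prob p S x + ?g S * (1 - swap_prob p S x))"
      using r g by (simp add: ennreal_mult ennreal_plus)
    finally show ?thesis by (simp add: algebra_simps)
  qed
  have nonneg: "0 \<le> ?g S + swap_prob p S x * (?g (swap S x) - ?g S)" for x
  proof -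
    have "0 \<le> ?g S * (1 - swap_prob p S x) + swap_prob p S x * ?g (swap S x)"
      using p g by (intro add_nonneg_nonneg mult_nonneg_nonneg) (auto simp: swap_prob_def)
    then show ?thesis by (simp add: algebra_simps)
  qed
  have "(\<integral>\<^sup>+c. ennreal (g c) \<partial>exclusion_voter_step 0 p (abs_config S)) =
      (\<Sum>x\<in>?U. \<integral>\<^sup>+T. ennreal (?g T) \<partial>exclusion_move p S x) / ennreal (real (card ?U))"
    by (simp add: exclusion_step_abs[OF S] nn_integral_pmf_of_set[OF U(2,1)] ennreal_of_nat_eq_real_of_nat)
  also have "(\<Sum>x\<in>?U. \<integral>\<^sup>+T. ennreal (?g T) \<partial>exclusion_move p S x) =
      (\<Sum>x\<in>?U. ennreal (?g S + swap_prob p S x * (?g (swap S x) - ?g S)))"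
    by (rule sum.cong) (auto simp: move)
  also have "\<dots> = ennreal (\<Sum>x\<in>?U. ?g S + swap_prob p S x * (?g (swap S x) - ?g S))"
    by (rule sum_ennreal) (rule nonneg)
  also have "\<dots> \<le> ennreal (real (card ?U) * (r * ?g S))"
    using drift by (intro ennreal_leI, unfold sum.distrib sum_constant) (simp add: algebra_simps)
  finally have "(\<integral>\<^sup>+c. ennreal (g c) \<partial>exclusion_voter_step 0 p (abs_config S))
     \<le> ennreal (real (card ?U) * (r * ?g S)) / ennreal (real (card ?U))"
    by (simp add: divide_right_mono_ennreal)
  also have "\<dots> = ennreal (r * ?g S)"
  proof (cases "0 \<le> r * ?g S")
    case True
    then show ?thesis using cU by (subst divide_ennreal) auto
  next
    case False
    then have "real (card ?U) * (r * ?g S) \<le> 0" using cU by (simp add: mult_nonneg_nonpos)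
    then show ?thesis using False by (simp add: ennreal_neg)
  qed
  finally show ?thesis .
qed

lemma zone_height_sum_supermartingale:
  assumes v: "0 < v" "v < 1"
    and p: "0 \<le> p" "p \<le> 1" "p \<le> (1 - p) * v\<^sup>2"
    and u: "1 \<le> u" "2 * (u\<^sup>2 - 1) \<le> (1 - p) * (1 - v)\<^sup>2"
  shows "(\<integral>\<^sup>+c'. ennreal (u ^ zone_size c' * config_height_sum v c') \<partial>exclusion_voter_step 0 p c)
    \<le> ennreal (u ^ zone_size c * config_height_sum v c)"
proof (cases c rule: config_cases)
  case (1 S)
  have "(\<integral>\<^sup>+c'. ennreal (u ^ zone_size c' * config_height_sum v c') \<partial>exclusion_voter_step 0 p (abs_config S))
    \<le> ennreal (1 * (u ^ zone_size (abs_config S) * config_height_sum v (abs_config S)))"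
    using zone_height_sum_drift[OF 1(1) v p u] u config_height_sum_pos[OF v]
    by (intro nn_integral_exclusion_step 1 p)
       (auto simp: zone_size_abs config_height_sum_abs swap_hybrid_confs 1(1) intro: less_imp_le)
  with 1 show ?thesis by simp
qed

lemma inversion_power_supermartingale:
  assumes v: "0 < v" "v < 1"
    and p: "0 \<le> p" "p \<le> 1" "p \<le> (1 - p) * v\<^sup>2"
  shows "(\<integral>\<^sup>+c'. ennreal (v ^ inversions c') \<partial>exclusion_voter_step 0 p c)
    \<le> ennreal ((1 - (1 - p) * (1 - v)\<^sup>2 / 2) * v ^ inversions c)"
proof (cases c rule: config_cases)
  case (1 S)
  show ?thesis unfolding 1(2)
    using inversion_power_drift[OF 1(1) v p] v
    by (intro nn_integral_exclusion_step 1 p)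
       (auto simp: inversions_abs swap_hybrid_confs 1(1))
qed

section \<open>Marginals of a Markov chain\<close>

primrec state_pmf :: "('s \<Rightarrow> 's pmf) \<Rightarrow> 's \<Rightarrow> nat \<Rightarrow> 's pmf" where
  "state_pmf K s 0 = return_pmf s"
| "state_pmf K s (Suc n) = bind_pmf (state_pmf K s n) K"

lemma measurable_chain_law_component [measurable]:
  "(\<lambda>\<omega>. \<omega> n) \<in> measurable (chain_law K s) (count_space UNIV)"
  unfolding measurable_cong_sets[OF sets_chain_law refl]
  by (rule measurable_component_singleton) simp

text \<open>
  The law of the chain is a projective limit of measures built up by the kernels one coordinate at a
  time. The last coordinate of each of these measures has the iterated law, by induction on the number
  of coordinates, and the projective limit extends them.
\<close>

lemma emeasure_chain_law_state:
  fixes K :: "'s \<Rightarrow> 's pmf"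
  shows "emeasure (chain_law K s) {\<omega>. \<omega> n \<in> B} = emeasure (state_pmf K s n) B"
proof -
  interpret IT: Ionescu_Tulcea
    "\<lambda>n \<omega>. measure_pmf (chain_kernel K s n \<omega>)" "\<lambda>_. count_space (UNIV :: 's set)"
    by (rule Ionescu_Tulcea_chain_kernel)
  define N where "N n = PiM {0..<n} (\<lambda>_::nat. count_space (UNIV :: 's set))" for n
  define C where "C n = IT.C 0 n (\<lambda>_. undefined)" for n
  define E where "E n B = {\<omega> \<in> space (N (Suc n)). \<omega> n \<in> B}" for n B
  have C: "space (C n) = space (N n)" "sets (C n) = sets (N n)" for n
    using IT.space_C[of "\<lambda>_. undefined" 0 n] IT.sets_C[of "\<lambda>_. undefined" 0 n]
    by (simp_all add: space_PiM C_def N_def)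
  have comp: "(\<lambda>\<omega>. \<omega> n) \<in> measurable (N (Suc n)) (count_space UNIV)" for n
    unfolding N_def by (rule measurable_component_singleton) simp
  have E: "E n B \<in> sets (N (Suc n))" for n B
    using measurable_sets[OF comp[of n], of B] by (simp add: E_def vimage_def Int_def conj_commute)
  have compC: "(\<lambda>\<omega>. \<omega> n) \<in> measurable (C (Suc n)) (count_space UNIV)" for n
    unfolding measurable_cong_sets[OF C(2) refl] by (rule comp)
  have step: "emeasure (C (Suc n)) (E n B) =
      (\<integral>\<^sup>+\<omega>. emeasure (measure_pmf (chain_kernel K s n \<omega>)) B \<partial>C n)" for n B
  proof -
    have "emeasure (C (Suc n)) (E n B) = (\<integral>\<^sup>+\<omega>. emeasure (IT.eP n \<omega>) (E n B) \<partial>C n)"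
      using E[of n B] IT.measurable_eP[of n] unfolding C_def N_def
      by (simp, subst emeasure_bind[where N = "PiM {0..<Suc n} (\<lambda>_. count_space UNIV)"])
         (auto simp: C[unfolded C_def N_def] space_PiM
            measurable_cong_sets[OF C(2)[unfolded C_def N_def] refl])
    also have "\<dots> = (\<integral>\<^sup>+\<omega>. emeasure (measure_pmf (chain_kernel K s n \<omega>)) B \<partial>C n)"
    proof (rule nn_integral_cong)
      fix \<omega> assume "\<omega> \<in> space (C n)"
      then have w: "\<omega> \<in> space (N n)" by (simp add: C)
      have "emeasure (IT.eP n \<omega>) (E n B)
          = emeasure (measure_pmf (chain_kernel K s n \<omega>)) (fun_upd \<omega> n -` E n B)"
        using IT.emeasure_eP[OF w[unfolded N_def] E[unfolded N_def]] by simp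
      also have "fun_upd \<omega> n -` E n B = B"
        using w by (auto simp: E_def N_def space_PiM PiE_iff extensional_def)
      finally show "emeasure (IT.eP n \<omega>) (E n B) = emeasure (measure_pmf (chain_kernel K s n \<omega>)) B" .
    qed
    finally show ?thesis .
  qed
  have main: "emeasure (C (Suc n)) (E n B) = emeasure (state_pmf K s n) B" for n B
  proof (induction n arbitrary: B)
    case 0
    have "prob_space (C 0)" unfolding C_def by (rule IT.prob_space_C) (simp add: space_PiM)
    then have "emeasure (C 0) (space (C 0)) = 1" by (rule prob_space.emeasure_space_1)
    then show ?case by (simp add: step chain_kernel_def)
  next
    case (Suc n)
    have D: "distr (C (Suc n)) (count_space UNIV) (\<lambda>\<omega>. \<omega> n) = measure_pmf (state_pmf K s n)"
    proof (rule measure_eqI)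
      fix A
      have "emeasure (distr (C (Suc n)) (count_space UNIV) (\<lambda>\<omega>. \<omega> n)) A = emeasure (C (Suc n)) (E n A)"
        by (subst emeasure_distr[OF compC]) (auto simp: E_def C intro!: arg_cong2[of _ _ _ _ emeasure])
      then show "emeasure (distr (C (Suc n)) (count_space UNIV) (\<lambda>\<omega>. \<omega> n)) A
        = emeasure (state_pmf K s n) A" by (simp add: Suc.IH)
    qed simp
    have "emeasure (C (Suc (Suc n))) (E (Suc n) B) = (\<integral>\<^sup>+\<omega>. emeasure (measure_pmf (K (\<omega> n))) B \<partial>C (Suc n))"
      by (simp add: step chain_kernel_def)
    also have "\<dots> = (\<integral>\<^sup>+y. emeasure (measure_pmf (K y)) B
        \<partial>distr (C (Suc n)) (count_space UNIV) (\<lambda>\<omega>. \<omega> n))"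
      by (rule nn_integral_distr[symmetric, OF compC]) simp
    also have "\<dots> = emeasure (state_pmf K s (Suc n)) B" unfolding D by simp
    finally show ?case .
  qed
  have "{\<omega>. \<omega> n \<in> B} = IT.PF.emb UNIV {0..<Suc n} (E n B)"
    by (auto simp: prod_emb_def E_def N_def space_PiM)
  then have "emeasure (chain_law K s) {\<omega>. \<omega> n \<in> B} = emeasure (IT.CI {0..<Suc n}) (E n B)"
    unfolding chain_law_def using IT.lim[OF _ E[unfolded N_def]] by simp
  also have "\<dots> = emeasure (C (Suc n)) (IT.PF.emb {0..<Suc n} {0..<Suc n} (E n B))"
    unfolding C_def by (rule IT.emeasure_CI[OF _ E[unfolded N_def]]) simp
  also have "IT.PF.emb {0..<Suc n} {0..<Suc n} (E n B) = E n B"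
    by (rule prod_emb_id) (auto simp: E_def N_def space_PiM)
  finally show ?thesis by (simp add: main)
qed

lemma distr_chain_law:
  "distr (chain_law K s) (count_space UNIV) (\<lambda>\<omega>. \<omega> n) = measure_pmf (state_pmf K s n)"
proof (rule measure_eqI)
  fix B
  show "emeasure (distr (chain_law K s) (count_space UNIV) (\<lambda>\<omega>. \<omega> n)) B = emeasure (state_pmf K s n) B"
    by (subst emeasure_distr) (auto simp: space_chain_law vimage_def emeasure_chain_law_state)
qed simp

lemma nn_integral_chain_law:
  "(\<integral>\<^sup>+\<omega>. g (\<omega> n) \<partial>chain_law K s) = (\<integral>\<^sup>+y. g y \<partial>state_pmf K s n)"
  unfolding distr_chain_law[symmetric] by (rule nn_integral_distr[symmetric]) simp_all

lemma AE_chain_law: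
  assumes "\<And>n y. y \<in> set_pmf (state_pmf K s n) \<Longrightarrow> P n y"
  shows "AE \<omega> in chain_law K s. \<forall>n. P n (\<omega> n)"
proof (subst AE_all_countable, intro allI)
  fix n
  have "AE y in distr (chain_law K s) (count_space UNIV) (\<lambda>\<omega>. \<omega> n). P n y"
    unfolding distr_chain_law using assms by (simp add: AE_measure_pmf_iff)
  then show "AE \<omega> in chain_law K s. P n (\<omega> n)" by (subst (asm) AE_distr_iff) simp_all
qed

lemma nn_integral_state_pmf_le:
  fixes K :: "'s \<Rightarrow> 's pmf"
  assumes "\<And>y. (\<integral>\<^sup>+z. g z \<partial>measure_pmf (K y)) \<le> r * g y"
  shows "(\<integral>\<^sup>+y. g y \<partial>state_pmf K s n) \<le> r ^ n * g s"
proof (induction n)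
  case (Suc n)
  have "(\<integral>\<^sup>+y. g y \<partial>state_pmf K s (Suc n)) \<le> (\<integral>\<^sup>+y. r * g y \<partial>state_pmf K s n)"
    by (simp add: assms nn_integral_mono)
  also have "\<dots> = r * (\<integral>\<^sup>+y. g y \<partial>state_pmf K s n)" by (rule nn_integral_cmult) simp
  also have "\<dots> \<le> r * (r ^ n * g s)" by (intro mult_left_mono Suc) simp
  finally show ?case by (simp add: mult.assoc)
qed simp

text \<open>
  The Borel--Cantelli argument in expectation form: the sum over all times has finite expectation,
  hence it is finite almost surely and its terms tend to zero.
\<close>

lemma AE_chain_law_eventually_less_1:
  fixes g :: "nat \<Rightarrow> 's \<Rightarrow> real"
  assumes g: "\<And>n y. 0 \<le> g n y"
    and le: "\<And>n. (\<integral>\<^sup>+y. g n y \<partial>state_pmf K s n) \<le> ennreal (b n)"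
    and b: "\<And>n. 0 \<le> b n" "summable b"
  shows "AE \<omega> in chain_law K s. \<forall>\<^sub>F n in sequentially. g n (\<omega> n) < 1"
proof -
  have m: "(\<lambda>\<omega>. ennreal (g n (\<omega> n))) \<in> borel_measurable (chain_law K s)" for n
    by (rule measurable_compose[OF measurable_chain_law_component]) simp
  have "(\<integral>\<^sup>+\<omega>. (\<Sum>n. ennreal (g n (\<omega> n))) \<partial>chain_law K s)
      = (\<Sum>n. \<integral>\<^sup>+\<omega>. ennreal (g n (\<omega> n)) \<partial>chain_law K s)"
    by (rule nn_integral_suminf[OF m])
  also have "\<dots> = (\<Sum>n. \<integral>\<^sup>+y. g n y \<partial>state_pmf K s n)"
    by (intro suminf_cong nn_integral_chain_law)
  also have "\<dots> \<le> (\<Sum>n. ennreal (b n))" by (intro suminf_le le) auto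
  also have "\<dots> < \<infinity>" using suminf_ennreal2[OF b] by simp
  finally have "AE \<omega> in chain_law K s. (\<Sum>n. ennreal (g n (\<omega> n))) \<noteq> \<infinity>"
    by (intro nn_integral_noteq_infinite borel_measurable_suminf_order m) auto
  then show ?thesis
  proof eventually_elim
    case (elim \<omega>)
    then have "summable (\<lambda>n. g n (\<omega> n))" using g by (intro summable_suminf_not_top) auto
    then have "(\<lambda>n. g n (\<omega> n)) \<longlonglongrightarrow> 0" by (rule summable_LIMSEQ_zero)
    then show ?case by (rule order_tendstoD) simp
  qed
qed

section \<open>Almost sure bounds\<close>

lemma inversions_state_pmf:
  "c \<in> set_pmf (state_pmf (exclusion_voter_step 0 p) c0 t) \<Longrightarrow> inversions c \<le> inversions c0 + t"
proof (induction t arbitrary: c)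
  case (Suc t)
  then obtain c' where "c' \<in> set_pmf (state_pmf (exclusion_voter_step 0 p) c0 t)"
    "c \<in> set_pmf (exclusion_voter_step 0 p c')" by auto
  with Suc.IH[of c'] inversions_step[of c p c'] show ?case by simp
qed simp

lemma AE_inversions_le:
  "AE \<xi> in exclusion_voter_law 0 p c0. \<forall>t. inversions (\<xi> t) \<le> inversions c0 + t"
  unfolding exclusion_voter_law_def by (rule AE_chain_law) (rule inversions_state_pmf)

lemma AE_num_blocks_le:
  "AE \<xi> in exclusion_voter_law 0 p c0. \<forall>t\<ge>1.
     real (MAX s\<in>{0..t}. num_blocks (\<xi> s)) \<le> sqrt (2 * (real (inversions c0) + 1)) * real t powr (1/2)"
  using AE_inversions_le
proof eventually_elim
  case (elim \<xi>)
  show ?case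
  proof (intro allI impI)
    fix t :: nat assume t: "1 \<le> t"
    have "(MAX s\<in>{0..t}. num_blocks (\<xi> s)) \<in> (\<lambda>s. num_blocks (\<xi> s)) ` {0..t}"
      by (rule Max_in) auto
    then obtain s where s: "s \<le> t" "(MAX s\<in>{0..t}. num_blocks (\<xi> s)) = num_blocks (\<xi> s)"
      by (metis (no_types, lifting) atLeastAtMost_iff imageE)
    have "inversions (\<xi> s) \<le> inversions c0 + t" using elim[rule_format, of s] s(1) by linarith
    then have "(num_blocks (\<xi> s))\<^sup>2 \<le> 2 * (inversions c0 + t)"
      by (intro order_trans[OF num_blocks_le[of "\<xi> s"]] mult_le_mono2)
    also have "\<dots> \<le> 2 * (inversions c0 + 1) * t"
      using mult_le_mono2[OF t, of "inversions c0"] by (simp add: algebra_simps)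
    finally have "real ((num_blocks (\<xi> s))\<^sup>2) \<le> real (2 * (inversions c0 + 1) * t)"
      by (simp only: of_nat_le_iff)
    then have "real (num_blocks (\<xi> s)) \<le> sqrt (2 * (real (inversions c0) + 1) * real t)"
      by (intro real_le_rsqrt) (simp add: algebra_simps)
    then show "real (MAX s\<in>{0..t}. num_blocks (\<xi> s)) \<le>
        sqrt (2 * (real (inversions c0) + 1)) * real t powr (1/2)"
      by (simp add: s(2) powr_half_sqrt real_sqrt_mult)
  qed
qed

text \<open>
  The expectation of \<open>v\<close> to the power of the number of inversions decays like \<open>r\<^sup>t\<close>. Splitting
  \<open>r = \<rho>\<^sup>2\<close>, one factor \<open>\<rho>\<^sup>t\<close> serves as the threshold and the other one makes the expectations summable.
\<close>

lemma AE_inversions_ge: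
  assumes v: "0 < v" "v < 1"
    and p: "0 \<le> p" "p < 1" "p \<le> (1 - p) * v\<^sup>2"
  obtains a where "0 < a"
    "\<And>c0. AE \<xi> in exclusion_voter_law 0 p c0. \<forall>\<^sub>F t in sequentially. a * real t \<le> real (inversions (\<xi> t))"
proof -
  define r where "r = 1 - (1 - p) * (1 - v)\<^sup>2 / 2"
  define \<rho> where "\<rho> = sqrt r"
  have "0 < (1 - p) * (1 - v)\<^sup>2" using p v by simp
  moreover have "(1 - p) * (1 - v)\<^sup>2 \<le> 1" using p v by (intro mult_le_one) (auto simp: power_le_one)
  ultimately have r: "0 < r" "r < 1" by (simp_all add: r_def)
  then have \<rho>: "0 < \<rho>" "\<rho> < 1" "r = \<rho> * \<rho>" by (simp_all add: \<rho>_def)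
  define a where "a = ln \<rho> / ln v"
  have a: "0 < a" using \<rho> v by (simp add: a_def divide_neg_neg)
  have "AE \<xi> in exclusion_voter_law 0 p c0. \<forall>\<^sub>F t in sequentially. a * real t \<le> real (inversions (\<xi> t))" for c0
  proof -
    have "AE \<xi> in exclusion_voter_law 0 p c0. \<forall>\<^sub>F t in sequentially. v ^ inversions (\<xi> t) / \<rho> ^ t < 1"
      unfolding exclusion_voter_law_def
    proof (rule AE_chain_law_eventually_less_1[where b = "\<lambda>t. v ^ inversions c0 * \<rho> ^ t"])
      fix t
      have "(\<integral>\<^sup>+c. ennreal (v ^ inversions c) \<partial>state_pmf (exclusion_voter_step 0 p) c0 t)
          \<le> ennreal r ^ t * ennreal (v ^ inversions c0)"
      proof (rule nn_integral_state_pmf_le)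
        fix c
        show "(\<integral>\<^sup>+z. ennreal (v ^ inversions z) \<partial>exclusion_voter_step 0 p c)
           \<le> ennreal r * ennreal (v ^ inversions c)"
          using inversion_power_supermartingale[of v p c] v p r by (simp add: ennreal_mult r_def)
      qed
      also have "\<dots> = ennreal (v ^ inversions c0 * \<rho> ^ t * \<rho> ^ t)"
        using r v \<rho> by (simp add: ennreal_power ennreal_mult' power_mult_distrib mult_ac)
      finally have *: "(\<integral>\<^sup>+c. ennreal (v ^ inversions c) \<partial>state_pmf (exclusion_voter_step 0 p) c0 t)
          \<le> ennreal (v ^ inversions c0 * \<rho> ^ t * \<rho> ^ t)" .
      have "(\<integral>\<^sup>+c. ennreal (v ^ inversions c / \<rho> ^ t) \<partial>state_pmf (exclusion_voter_step 0 p) c0 t)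
        = (\<integral>\<^sup>+c. ennreal (1 / \<rho> ^ t) * ennreal (v ^ inversions c) \<partial>state_pmf (exclusion_voter_step 0 p) c0 t)"
        using \<rho> v by (simp flip: ennreal_mult)
      also have "\<dots> = ennreal (1 / \<rho> ^ t) * (\<integral>\<^sup>+c. ennreal (v ^ inversions c) \<partial>state_pmf (exclusion_voter_step 0 p) c0 t)"
        by (rule nn_integral_cmult) simp
      also have "\<dots> \<le> ennreal (1 / \<rho> ^ t) * ennreal (v ^ inversions c0 * \<rho> ^ t * \<rho> ^ t)"
        by (intro mult_left_mono *) simp
      also have "\<dots> = ennreal (v ^ inversions c0 * \<rho> ^ t)"
        using \<rho> v by (simp flip: ennreal_mult)
      finally show "(\<integral>\<^sup>+c. ennreal (v ^ inversions c / \<rho> ^ t) \<partial>state_pmf (exclusion_voter_step 0 p) c0 t)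
        \<le> ennreal (v ^ inversions c0 * \<rho> ^ t)" .
    qed (use v \<rho> in \<open>auto intro!: summable_mult summable_geometric\<close>)
    then show ?thesis
    proof eventually_elim
      case (elim \<xi>)
      then show ?case
      proof eventually_elim
        case (elim t)
        then have "v ^ inversions (\<xi> t) < \<rho> ^ t" using \<rho> by simp
        then have "ln (v ^ inversions (\<xi> t)) < ln (\<rho> ^ t)"
          using \<rho> v by (subst ln_less_cancel_iff) auto
        then have "real (inversions (\<xi> t)) * ln v < real t * ln \<rho>"
          using \<rho> v by (simp add: ln_realpow)
        moreover have "ln v < 0" using v by simp
        ultimately show ?case by (simp add: a_def field_simps)
      qed
    qed
  qed
  with a show ?thesis using that by blast
qed

text \<open>
  The supermartingale has bounded expectation, so after division by \<open>t\<^sup>2\<close> its expectations are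
  summable and it is eventually below \<open>t\<^sup>2\<close>. Taking logarithms bounds the zone by the logarithm of time and
  the lowest height.
\<close>

lemma AE_zone_size_le:
  assumes v: "0 < v" "v < 1"
    and p: "0 \<le> p" "p < 1" "p \<le> (1 - p) * v\<^sup>2"
  obtains a b where "0 < a" "0 < b"
    "AE \<xi> in exclusion_voter_law 0 p c0. \<forall>\<^sub>F t in sequentially.
       real (zone_size (\<xi> t)) \<le> a * ln (real t) + b * sqrt (real (inversions c0 + t))"
proof -
  define \<kappa> where "\<kappa> = (1 - p) * (1 - v)\<^sup>2"
  \<comment> \<open>the largest \<open>u\<close> with \<open>2 (u\<^sup>2 - 1) \<le> \<kappa>\<close>\<close>
  define u where "u = sqrt (1 + \<kappa> / 2)"
  have "0 < \<kappa>" using p v by (simp add: \<kappa>_def)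
  then have u: "1 < u" "2 * (u\<^sup>2 - 1) \<le> (1 - p) * (1 - v)\<^sup>2"
    by (simp_all add: u_def \<kappa>_def[symmetric])
  define W where "W c = u ^ zone_size c * config_height_sum v c" for c
  have W: "0 < W c" for c using u config_height_sum_pos[OF v] by (simp add: W_def)
  have "AE \<xi> in exclusion_voter_law 0 p c0. \<forall>\<^sub>F t in sequentially. W (\<xi> t) / (real t)\<^sup>2 < 1"
    unfolding exclusion_voter_law_def
  proof (rule AE_chain_law_eventually_less_1[where b = "\<lambda>t. W c0 * inverse ((real t)\<^sup>2)"])
    fix t
    have *: "(\<integral>\<^sup>+c. ennreal (W c) \<partial>state_pmf (exclusion_voter_step 0 p) c0 t) \<le> 1 ^ t * ennreal (W c0)"
      using zone_height_sum_supermartingale[OF v p(1) _ p(3), of u] u p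
      by (intro nn_integral_state_pmf_le) (simp add: W_def)
    have "(\<integral>\<^sup>+c. ennreal (W c / (real t)\<^sup>2) \<partial>state_pmf (exclusion_voter_step 0 p) c0 t)
      = (\<integral>\<^sup>+c. ennreal (inverse ((real t)\<^sup>2)) * ennreal (W c) \<partial>state_pmf (exclusion_voter_step 0 p) c0 t)"
      using W by (simp add: divide_inverse mult.commute less_imp_le flip: ennreal_mult)
    also have "\<dots> = ennreal (inverse ((real t)\<^sup>2)) * (\<integral>\<^sup>+c. ennreal (W c) \<partial>state_pmf (exclusion_voter_step 0 p) c0 t)"
      by (rule nn_integral_cmult) simp
    also have "\<dots> \<le> ennreal (inverse ((real t)\<^sup>2)) * (1 ^ t * ennreal (W c0))"
      by (intro mult_left_mono *) simp
    also have "\<dots> = ennreal (W c0 * inverse ((real t)\<^sup>2))"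
      using W[of c0] by (simp add: mult.commute less_imp_le flip: ennreal_mult)
    finally show "(\<integral>\<^sup>+c. ennreal (W c / (real t)\<^sup>2) \<partial>state_pmf (exclusion_voter_step 0 p) c0 t)
      \<le> ennreal (W c0 * inverse ((real t)\<^sup>2))" .
  qed (use W in \<open>auto intro!: summable_mult inverse_power_summable simp: less_imp_le\<close>)
  then have "AE \<xi> in exclusion_voter_law 0 p c0. \<forall>\<^sub>F t in sequentially.
       real (zone_size (\<xi> t)) \<le> 2 / ln u * ln (real t) + 2 * ln (1 / v) / ln u * sqrt (real (inversions c0 + t))"
    using AE_inversions_le[where p = p and ?c0.0 = c0]
  proof eventually_elim
    case (elim \<xi>)
    have inv: "inversions (\<xi> t) \<le> inversions c0 + t" for t using elim by simp
    have "\<forall>\<^sub>F t in sequentially. W (\<xi> t) / (real t)\<^sup>2 < 1" using elim by simp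
    then show ?case using eventually_gt_at_top[of 0]
    proof eventually_elim
      case (elim t)
      then have t: "W (\<xi> t) < (real t)\<^sup>2" "0 < t" by simp_all
      obtain h where h: "h\<^sup>2 \<le> 4 * inversions (\<xi> t)" "v ^ h \<le> config_height_sum v (\<xi> t)"
        using v by (rule config_height_sum_ge)
      have "u ^ zone_size (\<xi> t) * v ^ h \<le> W (\<xi> t)"
        unfolding W_def using h u by (intro mult_left_mono) auto
      with t have "u ^ zone_size (\<xi> t) * v ^ h < (real t)\<^sup>2" by simp
      then have "ln (u ^ zone_size (\<xi> t) * v ^ h) < ln ((real t)\<^sup>2)"
        using u v t by (subst ln_less_cancel_iff) auto
      then have l: "real (zone_size (\<xi> t)) * ln u < 2 * ln (real t) + real h * ln (1 / v)"
        using u v t by (simp add: ln_mult ln_realpow ln_div)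
      have "h\<^sup>2 \<le> 4 * (inversions c0 + t)"
        using h(1) mult_le_mono2[OF inv[of t], of 4] by (rule order_trans)
      then have "real (h\<^sup>2) \<le> real (4 * (inversions c0 + t))" by (simp only: of_nat_le_iff)
      then have "real h \<le> sqrt (4 * real (inversions c0 + t))" by (intro real_le_rsqrt) simp
      then have "real h \<le> 2 * sqrt (real (inversions c0 + t))" by (simp only: real_sqrt_mult real_sqrt_four)
      then have "real h * ln (1 / v) \<le> 2 * sqrt (real (inversions c0 + t)) * ln (1 / v)"
        using v by (intro mult_right_mono) auto
      with l have "real (zone_size (\<xi> t)) * ln u
          \<le> 2 * ln (real t) + 2 * sqrt (real (inversions c0 + t)) * ln (1 / v)" by linarith
      then have "real (zone_size (\<xi> t))
          \<le> (2 * ln (real t) + 2 * sqrt (real (inversions c0 + t)) * ln (1 / v)) / ln u"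
        using u by (simp add: pos_le_divide_eq)
      then show ?case by (simp add: add_divide_distrib mult_ac)
    qed
  qed
  moreover have "0 < 2 / ln u" "0 < 2 * ln (1 / v) / ln u" using u v by simp_all
  ultimately show ?thesis using that by blast
qed

text \<open>
  The bound of the preceding lemma is monotone in time and of smaller order than \<open>t\<^bsup>2/3\<^esup>\<close>, so it
  also controls the running maximum once the finitely many earlier times are overtaken.
\<close>

lemma AE_max_zone_size_le:
  assumes v: "0 < v" "v < 1"
    and p: "0 \<le> p" "p < 1" "p \<le> (1 - p) * v\<^sup>2" and "0 < \<epsilon>"
  shows "AE \<xi> in exclusion_voter_law 0 p c0. \<forall>\<^sub>F t in sequentially.
     real (MAX s\<in>{0..t}. zone_size (\<xi> s)) \<le> real t powr (2/3) * ln (real t) powr (1/3 + \<epsilon>)"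
proof -
  obtain a b where ab: "0 < a" "0 < b" and AE:
    "AE \<xi> in exclusion_voter_law 0 p c0. \<forall>\<^sub>F t in sequentially.
       real (zone_size (\<xi> t)) \<le> a * ln (real t) + b * sqrt (real (inversions c0 + t))"
    using v p by (rule AE_zone_size_le)
  from AE show ?thesis
  proof eventually_elim
    case (elim \<xi>)
    define B where "B t = a * ln (real t) + b * sqrt (real (inversions c0 + t))" for t
    have mono: "B s \<le> B t" if "1 \<le> s" "s \<le> t" for s t
      using that ab unfolding B_def by (intro add_mono mult_left_mono) auto
    obtain t0 where t0: "1 \<le> t0" "\<And>t. t0 \<le> t \<Longrightarrow> real (zone_size (\<xi> t)) \<le> B t"
      using eventually_conj[OF elim eventually_ge_at_top[of 1]]
      unfolding eventually_sequentially B_def by (metis le_refl)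
    define m where "m = (MAX s\<in>{0..t0}. zone_size (\<xi> s))"
    have "\<forall>\<^sub>F t in sequentially. real m \<le> real t powr (2/3)" by real_asymp
    moreover have "\<forall>\<^sub>F t in sequentially. B t \<le> real t powr (2/3)"
      unfolding B_def of_nat_add using ab by real_asymp
    moreover have "\<forall>\<^sub>F t in sequentially. 1 \<le> ln (real t)" by real_asymp
    ultimately show ?case using eventually_ge_at_top[of t0]
    proof eventually_elim
      case (elim t)
      have "(MAX s\<in>{0..t}. zone_size (\<xi> s)) \<in> (\<lambda>s. zone_size (\<xi> s)) ` {0..t}"
        by (rule Max_in) auto
      then obtain s where s: "s \<le> t" "(MAX s\<in>{0..t}. zone_size (\<xi> s)) = zone_size (\<xi> s)"
        by (metis (no_types, lifting) atLeastAtMost_iff imageE)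
      have "real (zone_size (\<xi> s)) \<le> real t powr (2/3)"
      proof (cases "s \<le> t0")
        case True
        then have "zone_size (\<xi> s) \<le> m" unfolding m_def by (intro Max_ge) auto
        with elim show ?thesis by linarith
      next
        case False
        then show ?thesis using t0(2)[of s] mono[of s t] t0(1) s elim by simp
      qed
      also have "\<dots> \<le> real t powr (2/3) * ln (real t) powr (1/3 + \<epsilon>)"
        using elim \<open>0 < \<epsilon>\<close> mult_left_mono[OF ge_one_powr_ge_zero[of "ln (real t)" "1/3 + \<epsilon>"], of "real t powr (2/3)"]
        by simp
      finally show ?case by (simp add: s(2))
    qed
  qed
qed

theorem theorem8:
  shows
    "(\<forall>S0. \<exists>C::real. C > 0 \<and>
        (\<forall>p::real. 0 \<le> p \<and> p \<le> 1 \<longrightarrow>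
          (AE \<xi> in exclusion_voter_law 0 p S0.
             \<forall>t\<ge>1. real (MAX s\<in>{0..t}. num_blocks (\<xi> s)) \<le> C * real t powr (1/2))))
     \<and>
     (\<forall>p::real. 0 \<le> p \<and> p < 1/2 \<longrightarrow>
        (\<forall>S0. \<forall>\<epsilon>::real. \<epsilon> > 0 \<longrightarrow>
          (AE \<xi> in exclusion_voter_law 0 p S0.
             \<forall>\<^sub>F t in sequentially.
               real (MAX s\<in>{0..t}. zone_size (\<xi> s))
                 \<le> real t powr (2/3) * ln (real t) powr (1/3 + \<epsilon>)))
        \<and>
        (\<exists>c0::real. c0 > 0 \<and>
          (\<forall>c. 0 < c \<and> c < c0 \<longrightarrow>
            (\<forall>S0. AE \<xi> in exclusion_voter_law 0 p S0.
               \<forall>\<^sub>F t in sequentially.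
                 real (zone_size (\<xi> t)) \<ge> c * real t powr (1/2)))))"
proof (intro conjI allI impI)
  fix S0
  show "\<exists>C::real. C > 0 \<and> (\<forall>p::real. 0 \<le> p \<and> p \<le> 1 \<longrightarrow>
          (AE \<xi> in exclusion_voter_law 0 p S0.
             \<forall>t\<ge>1. real (MAX s\<in>{0..t}. num_blocks (\<xi> s)) \<le> C * real t powr (1/2)))"
    by (intro exI[of _ "sqrt (2 * (real (inversions S0) + 1))"] conjI allI impI AE_num_blocks_le) simp
next
  fix p :: real assume p: "0 \<le> p \<and> p < 1/2"
  \<comment> \<open>the arithmetic mean of 1 and \<open>p / (1 - p)\<close>, hence at least their geometric mean\<close>
  define v where "v = 1 / (2 * (1 - p))"
  have v: "0 < v" "v < 1" using p by (auto simp: v_def field_simps)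
  have "0 \<le> (1 - 2 * p)\<^sup>2" by simp
  then have "p \<le> 1 / (4 * (1 - p))"
    using p by (simp add: field_simps power2_eq_square)
  also have "\<dots> = (1 - p) * v\<^sup>2"
  proof -
    have "q * (1 / (2 * q))\<^sup>2 = 1 / (4 * q)" if "0 < q" for q :: real
      using that by (simp add: power2_eq_square)
    from this[of "1 - p"] show ?thesis using p unfolding v_def by simp
  qed
  finally have pv: "p \<le> (1 - p) * v\<^sup>2" .
  note prems = v conjunct1[OF p] _ pv
  show "AE \<xi> in exclusion_voter_law 0 p S0. \<forall>\<^sub>F t in sequentially.
      real (MAX s\<in>{0..t}. zone_size (\<xi> s)) \<le> real t powr (2/3) * ln (real t) powr (1/3 + \<epsilon>)"
    if "0 < \<epsilon>" for S0 \<epsilon>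
    using that p by (intro AE_max_zone_size_le[OF prems]) auto
  obtain a where a: "0 < a" and
    AE: "\<And>S0. AE \<xi> in exclusion_voter_law 0 p S0. \<forall>\<^sub>F t in sequentially. a * real t \<le> real (inversions (\<xi> t))"
    using AE_inversions_ge[OF prems] p by auto
  show "\<exists>c0::real. c0 > 0 \<and> (\<forall>c. 0 < c \<and> c < c0 \<longrightarrow>
            (\<forall>S0. AE \<xi> in exclusion_voter_law 0 p S0.
               \<forall>\<^sub>F t in sequentially. real (zone_size (\<xi> t)) \<ge> c * real t powr (1/2)))"
  proof (intro exI[of _ "2 * sqrt a"] conjI allI impI)
    fix c S0 assume c: "0 < c \<and> c < 2 * sqrt a"
    show "AE \<xi> in exclusion_voter_law 0 p S0.
        \<forall>\<^sub>F t in sequentially. real (zone_size (\<xi> t)) \<ge> c * real t powr (1/2)"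
      using AE
    proof eventually_elim
      case (elim \<xi>)
      then show ?case
      proof eventually_elim
        case (elim t)
        have "real (4 * inversions (\<xi> t)) \<le> real ((zone_size (\<xi> t))\<^sup>2)"
          unfolding of_nat_le_iff by (rule zone_size_ge)
        with elim have "4 * (a * real t) \<le> (real (zone_size (\<xi> t)))\<^sup>2" by simp
        then have "sqrt (4 * (a * real t)) \<le> real (zone_size (\<xi> t))"
          by (rule real_le_lsqrt[rotated]) simp
        moreover have "c * sqrt (real t) \<le> 2 * sqrt a * sqrt (real t)"
          using c by (intro mult_right_mono) auto
        ultimately show ?case by (simp add: powr_half_sqrt real_sqrt_mult)
      qed
    qed
  qed (use a in simp)
qed

end
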